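(* Let $M,N\in\mathbb{N}$ (positive integers). Then for every $H\in OPW([0,N]\times[-\tfrac{M}{2},\tfrac{M}{2}])$, $$\|H\|_{HS}^2=\frac{1}{M^2N}\sum_{j=0}^{MN-1}\Big\|H\Big(\sum_{n\in\mathbb{Z}}e^{2\pi i jn/(MN)}\,\delta_{n/M}\Big)\Big\|_{L^2(\mathbb{R})}^2 .$$
   Context: Hilbert-Schmidt operators: $HS(L^2(\mathbb{R}))$ is the space of operators $Hf(x)=\int\kappa_H(x,t)f(t)\,dt$ with kernel $\kappa_H\in L^2(\mathbb{R}^2)$, and $\|H\|_{HS}=\|\kappa_H\|_{L^2}$. The time-varying impulse response is $h_H(t,x)=\kappa_H(x,x-t)$, so that $Hf(x)=\int h_H(t,x)f(x-t)\,dt$, and the spreading function is $\eta_H(t,\nu)=\int h_H(t,x)e^{-2\pi i x\nu}\,dx$ (in the $L^2$ sense); it is the symplectic Fourier transform of the Kohn-Nirenberg symbol of $H$. For $S\subseteq\mathbb{R}^2$, $OPW(S)=\{H\in HS(L^2(\mathbb{R})): \operatorname{supp}\eta_H\subseteq S\}$. For $S$ compact, every $H\in OPW(S)$ extends to a bounded operator from $S_0'(\mathbb{R})$ (the dual of the Feichtinger algebra) to $L^2(\mathbb{R})$; on $f=\sum_k c_k\delta_{\lambda_k}$ it acts by $(Hf)(x)=\sum_k c_k\kappa_H(x,\lambda_k)=\sum_k c_kh_H(x-\lambda_k,x)$, where for a.e. $t$ the function $h_H(t,\cdot)$ is taken to be its continuous representative $x\mapsto\int\eta_H(t,\nu)e^{2\pi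 i x\nu}\,d\nu$. *)

theory Defs
  imports "HOL-Analysis.Analysis"
begin

text \<open>
  Elements of \<open>L\<^sup>2\<close> are represented by Borel functions, and an operator on \<open>L\<^sup>2(\<real>)\<close> by a map on
  functions of which only the values on square-integrable functions, up to null sets, matter.
\<close>

definition L2 :: "'a measure \<Rightarrow> ('a \<Rightarrow> complex) set" where
  "L2 \<mu> = {f \<in> borel_measurable \<mu>. integrable \<mu> (\<lambda>x. (norm (f x))\<^sup>2)}"

definition L2_norm :: "'a measure \<Rightarrow> ('a \<Rightarrow> complex) \<Rightarrow> real" where
  "L2_norm \<mu> f = sqrt (\<integral>x. (norm (f x))\<^sup>2 \<partial>\<mu>)"

type_synonym operator = "(real \<Rightarrow> complex) \<Rightarrow> (real \<Rightarrow> complex)"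

definition is_HS_kernel :: "operator \<Rightarrow> (real \<times> real \<Rightarrow> complex) \<Rightarrow> bool" where
  "is_HS_kernel H \<kappa> \<longleftrightarrow> \<kappa> \<in> L2 lborel \<and>
     (\<forall>f \<in> L2 lborel. AE x in lborel. H f x = (\<integral>t. \<kappa> (x, t) * f t \<partial>lborel))"

definition HS :: "operator set" where
  "HS = {H. \<exists>\<kappa>. is_HS_kernel H \<kappa>}"

text \<open>The kernel of an operator in \<^const>\<open>HS\<close> is unique up to null sets; we fix a representative.\<close>

definition HS_kernel :: "operator \<Rightarrow> real \<times> real \<Rightarrow> complex" where
  "HS_kernel H = (SOME \<kappa>. is_HS_kernel H \<kappa>)"

definition HS_norm :: "operator \<Rightarrow> real" where
  "HS_norm H = L2_norm lborel (HS_kernel H)"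

definition impulse_response :: "operator \<Rightarrow> real \<Rightarrow> real \<Rightarrow> complex" where
  "impulse_response H t x = HS_kernel H (x, x - t)"

text \<open>
  The Fourier integral \<open>\<eta>(t, \<nu>) = \<integral> h(t, x) e\<^bsup>-2\<pi>ix\<nu>\<^esup> dx\<close> in the \<open>L\<^sup>2\<close> sense: \<open>\<eta>\<close> is the limit in
  \<open>L\<^sup>2(\<real>\<^sup>2)\<close> of the integrals truncated to \<open>[-R, R]\<close>. These exist for almost every \<open>t\<close>, because
  \<open>h(t, \<cdot>)\<close> is then square-integrable.
\<close>

definition is_spreading_function :: "operator \<Rightarrow> (real \<times> real \<Rightarrow> complex) \<Rightarrow> bool" where
  "is_spreading_function H \<eta> \<longleftrightarrow> \<eta> \<in> L2 lborel \<and>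
     ((\<lambda>R. L2_norm lborel (\<lambda>(t, \<nu>). \<eta> (t, \<nu>) -
         (\<integral>x\<in>{-R..R}. impulse_response H t x * cis (- 2 * pi * x * \<nu>) \<partial>lborel))) \<longlongrightarrow> 0) at_top"

definition spreading_function :: "operator \<Rightarrow> real \<times> real \<Rightarrow> complex" where
  "spreading_function H = (SOME \<eta>. is_spreading_function H \<eta>)"

text \<open>The support of a class of functions modulo null sets.\<close>

definition ess_supp :: "('a::euclidean_space \<Rightarrow> complex) \<Rightarrow> 'a set" where
  "ess_supp f = {z. \<forall>U. open U \<and> z \<in> U \<longrightarrow> \<not> (AE w in lborel. w \<in> U \<longrightarrow> f w = 0)}"

text \<open>
  The spreading function always exists and is unique up to null sets, and \<^const>\<open>ess_supp\<close> is
  insensitive to null sets, so the choice of \<open>\<eta>\<close> below is immaterial.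
\<close>

definition OPW :: "(real \<times> real) set \<Rightarrow> operator set" where
  "OPW S = {H \<in> HS. \<exists>\<eta>. is_spreading_function H \<eta> \<and> ess_supp \<eta> \<subseteq> S}"

text \<open>
  For \<open>H \<in> OPW S\<close> with \<open>S\<close> compact: the continuous representative of \<open>h(t, \<cdot>)\<close>, for almost every \<open>t\<close>.
\<close>

definition cont_impulse_response :: "operator \<Rightarrow> real \<Rightarrow> real \<Rightarrow> complex" where
  "cont_impulse_response H t x = (\<integral>\<nu>. spreading_function H (t, \<nu>) * cis (2 * pi * x * \<nu>) \<partial>lborel)"

text \<open>
  The action of (the extension of) \<open>H \<in> OPW S\<close>, \<open>S\<close> compact, on the weighted sum of Dirac
  distributions \<open>\<Sum>\<^sub>k c(k) \<delta>\<^bsub>p(k)\<^esub>\<close>. For countably many \<open>k\<close> the resulting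
  function is determined up to null sets.
\<close>

definition apply_diracs :: "operator \<Rightarrow> ('k \<Rightarrow> complex) \<Rightarrow> ('k \<Rightarrow> real) \<Rightarrow> real \<Rightarrow> complex" where
  "apply_diracs H c p x = (\<Sum>\<^sub>\<infinity>k. c k * cont_impulse_response H (x - p k) x)"

end

theory Submission
  imports Defs
begin

text \<open>
  The Fourier transform of a function on \<open>[-R, R]\<close>, sampled along a coset of the lattice of step
  \<open>1/2R\<close>, consists of the Fourier coefficients of a modulation of that function; integrating
  Parseval's identity over all cosets gives Plancherel's identity for compact support, and letting
  \<open>R \<rightarrow> \<infinity>\<close> shows that \<open>H\<close> and its spreading function \<open>\<eta>\<close> have the same norm.

  On the other side, since \<open>\<eta>\<close> lives over \<open>t \<in> [0, N]\<close>, for almost every \<open>x\<close> only \<open>MN\<close> consecutive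
  \<open>n\<close> contribute to the images of the weighted combs at \<open>x\<close>. The characters \<open>j \<mapsto> e\<^bsup>2\<pi>ijn/(MN)\<^esup>\<close> of
  these \<open>n\<close> are orthogonal, so the sum over \<open>j\<close> of the squared values is \<open>MN \<Sum>\<^sub>n |h(x - n/M, x)|\<^sup>2\<close>.
  After the substitution \<open>t = x - n/M\<close> these are the values \<open>|h(t, t + n/M)|\<^sup>2\<close>, that is, the squared
  Fourier coefficients of \<open>\<eta>(t, \<cdot>) e\<^bsup>2\<pi>it\<cdot>\<^esup>\<close> on \<open>[-M/2, M/2]\<close>, and Parseval's identity applies again.
\<close>

section \<open>Trigonometric approximation\<close>

text \<open>\<open>L\<close> is the period. It stays a parameter because Parseval's identity is
  applied twice: with \<open>L = 2 * R\<close> for Plancherel's identity and with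
  \<open>L = real M\<close> for the samples.\<close>

definition trig :: "real \<Rightarrow> int \<Rightarrow> real \<Rightarrow> complex" where
  "trig L n x = cis (2 * pi * of_int n * x / L)"

text \<open>The Stone-Weierstrass theorem yields polynomials in the real coordinates of the plane.
  On the unit circle these are Laurent polynomials in \<open>cis \<theta>\<close>; the factor in
  front of \<open>poly P\<close> accounts for the negative powers.\<close>

lemma real_polynomial_function_cis:
  fixes q :: "complex \<Rightarrow> real"
  assumes "real_polynomial_function q"
  shows "\<exists>m P. \<forall>\<theta>. of_real (q (cis \<theta>)) = cis (- (real m * \<theta>)) * poly P (cis \<theta>)"
  using assms
proof induction
  case (linear f)
  interpret bounded_linear f by fact
  \<comment> \<open>A real-linear form on the plane is \<open>Re (w * z)\<close> for this
    \<open>w\<close>; on the circle this is half the sum of \<open>w * z\<close> and its conjugate,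
    hence the coefficients below.\<close>
  define w where "w = Complex (f 1) (- f \<i>)"
  have "of_real (f (cis \<theta>)) = cis (- (real 1 * \<theta>)) * poly [:cnj w / 2, 0, w / 2:] (cis \<theta>)" for \<theta>
  proof -
    have "cis \<theta> = cos \<theta> *\<^sub>R 1 + sin \<theta> *\<^sub>R \<i>"
      by (simp add: complex_eq_iff)
    then have "f (cis \<theta>) = cos \<theta> * f 1 + sin \<theta> * f \<i>"
      by (simp add: add scaleR)
    also have "complex_of_real \<dots> = (cnj w * cis (- \<theta>) + w * cis \<theta>) / 2"
      by (simp add: complex_eq_iff w_def)
    also have "\<dots> = cis (- \<theta>) * (cnj w / 2 + w / 2 * (cis \<theta> * cis \<theta>))"
      by (simp add: field_simps cis_mult flip: mult.assoc)
    finally show ?thesis by (simp add: algebra_simps)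
  qed
  then show ?case by blast
next
  case (const c)
  show ?case by (rule exI[of _ 0], rule exI[of _ "[:of_real c:]"]) simp
next
  case (add f g)
  then obtain m P n Q where
    "\<And>\<theta>. of_real (f (cis \<theta>)) = cis (- (real m * \<theta>)) * poly P (cis \<theta>)"
    "\<And>\<theta>. of_real (g (cis \<theta>)) = cis (- (real n * \<theta>)) * poly Q (cis \<theta>)" by auto
  \<comment> \<open>The monomials bring both summands to the common order
    \<open>m + n\<close>.\<close>
  then have "of_real (f (cis \<theta>) + g (cis \<theta>)) =
      cis (- (real (m + n) * \<theta>)) * poly (monom 1 n * P + monom 1 m * Q) (cis \<theta>)" for \<theta>
    by (simp add: poly_monom Complex.DeMoivre ring_distribs cis_mult flip: mult.assoc)
  then show ?case by blast
next
  case (mult f g)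
  then obtain m P n Q where
    "\<And>\<theta>. of_real (f (cis \<theta>)) = cis (- (real m * \<theta>)) * poly P (cis \<theta>)"
    "\<And>\<theta>. of_real (g (cis \<theta>)) = cis (- (real n * \<theta>)) * poly Q (cis \<theta>)" by auto
  moreover have "cis (- (real (m + n) * \<theta>)) = cis (- (real m * \<theta>)) * cis (- (real n * \<theta>))" for \<theta>
    by (simp add: cis_mult algebra_simps)
  ultimately have "of_real (f (cis \<theta>) * g (cis \<theta>)) =
      cis (- (real (m + n) * \<theta>)) * poly (P * Q) (cis \<theta>)" for \<theta>
    by (simp del: of_nat_add)
  then show ?case by blast
qed

lemma polynomial_function_cis:
  fixes g :: "complex \<Rightarrow> complex"
  assumes "polynomial_function g"
  shows "\<exists>m P. \<forall>\<theta>. g (cis \<theta>) = cis (- (real m * \<theta>)) * poly P (cis \<theta>)"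
proof -
  have "real_polynomial_function (Re \<circ> g)" "real_polynomial_function (Im \<circ> g)"
    using assms unfolding polynomial_function_def by (auto intro: bounded_linear_Re bounded_linear_Im)
  then obtain m P n Q where PQ:
    "\<And>\<theta>. of_real (Re (g (cis \<theta>))) = cis (- (real m * \<theta>)) * poly P (cis \<theta>)"
    "\<And>\<theta>. of_real (Im (g (cis \<theta>))) = cis (- (real n * \<theta>)) * poly Q (cis \<theta>)"
    using real_polynomial_function_cis[of "Re \<circ> g"] real_polynomial_function_cis[of "Im \<circ> g"] by auto
  have "g (cis \<theta>) = cis (- (real (m + n) * \<theta>)) * poly (monom 1 n * P + monom \<i> m * Q) (cis \<theta>)" for \<theta>
  proof -
    have "g (cis \<theta>) = of_real (Re (g (cis \<theta>))) + \<i> * of_real (Im (g (cis \<theta>)))"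
      by (rule complex_eq)
    then show ?thesis
      unfolding PQ by (simp add: poly_monom Complex.DeMoivre ring_distribs cis_mult flip: mult.assoc)
  qed
  then show ?thesis by blast
qed

text \<open>Stone-Weierstrass needs a continuous function on the circle. \<open>Arg\<close> jumps at
  \<open>-1\<close>, the image of both endpoints, and the equal boundary values of \<open>g\<close>
  repair the jump.\<close>

lemma continuous_on_circle_factor:
  fixes g :: "real \<Rightarrow> complex"
  assumes L: "L > 0" and g: "continuous_on {- L / 2..L / 2} g" and eq: "g (- L / 2) = g (L / 2)"
  obtains G where "continuous_on (sphere 0 1) G"
    "\<And>x. x \<in> {- L / 2..L / 2} \<Longrightarrow> G (cis (2 * pi * x / L)) = g x"
proof
  define I where "I = {- L / 2..L / 2}"
  define G where "G z = g (L * Arg z / (2 * pi))" for z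
  let ?e = "\<lambda>x. cis (2 * pi * x / L)"
  have G: "G (?e x) = g x" if "x \<in> I" for x
  proof (cases "x = - L / 2")
    case True
    then have "?e x = -1" using L by (simp add: complex_eq_iff)
    \<comment> \<open>\<open>Arg\<close> of \<open>-1\<close> is \<open>pi\<close>, so at the left
      endpoint \<open>G\<close> takes the value of \<open>g\<close> at the right one.\<close>
    then show ?thesis using True eq L Arg_cis[of pi] by (simp add: G_def)
  next
    case False
    then have "- 1 < 2 * x / L" "2 * x / L \<le> 1"
      using that L by (auto simp: field_simps I_def)
    from mult_strict_left_mono[OF this(1), of pi] mult_left_mono[OF this(2), of pi]
    have "- pi < 2 * pi * x / L" "2 * pi * x / L \<le> pi" by (simp_all add: mult_ac)
    then show ?thesis using L by (simp add: G_def cis_Arg_unique Arg_cis)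
  qed
  then show "\<And>x. x \<in> {- L / 2..L / 2} \<Longrightarrow> G (?e x) = g x" by (simp add: I_def)
  have surj: "\<exists>x\<in>I. z = ?e x" if "z \<in> sphere 0 1" for z
  proof (rule bexI[of _ "L * Arg z / (2 * pi)"])
    have "z = cis (Arg z)" using that cis_Arg[of z] by (cases "z = 0") (auto simp: sgn_div_norm)
    then show "z = ?e (L * Arg z / (2 * pi))" using L by simp
    have "L * (- pi) \<le> L * Arg z" "L * Arg z \<le> L * pi"
      using Arg_bounded[of z] L by (intro mult_left_mono; simp)+
    then show "L * Arg z / (2 * pi) \<in> I" by (auto simp: I_def field_simps)
  qed
  \<comment> \<open>A continuous surjection from a compact space onto a Hausdorff space is a quotient map.\<close>
  have "closed (sphere 0 1 \<inter> G -` B)" if "closed B" for B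
  proof -
    have "sphere 0 1 \<inter> G -` B = ?e ` (I \<inter> g -` B)"
      using surj by (force simp: G)
    moreover have "compact (I \<inter> g -` B)"
      using continuous_on_closed_vimage[of I g] g that
      by (metis I_def Int_commute closed_atLeastAtMost compact_Icc compact_Int_closed inf.left_idem inf_commute)
    moreover have "continuous_on (I \<inter> g -` B) ?e" by (intro continuous_intros) (use L in auto)
    ultimately show ?thesis by (simp add: compact_continuous_image compact_imp_closed)
  qed
  then show "continuous_on (sphere 0 1) G"
    by (subst continuous_on_closed_vimage) (auto simp: Int_commute)
qed

lemma trig_approx_continuous:
  fixes g :: "real \<Rightarrow> complex"
  assumes L: "L > 0" and g: "continuous_on {- L / 2..L / 2} g" and eq: "g (- L / 2) = g (L / 2)"
    and \<epsilon>: "\<epsilon> > 0"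
  obtains F a where "finite F"
    "\<And>x. x \<in> {- L / 2..L / 2} \<Longrightarrow> norm (g x - (\<Sum>n\<in>F. a n * trig L n x)) < \<epsilon>"
proof -
  obtain G where G: "continuous_on (sphere 0 1) G"
    "\<And>x. x \<in> {- L / 2..L / 2} \<Longrightarrow> G (cis (2 * pi * x / L)) = g x"
    using continuous_on_circle_factor[OF L g eq] by blast
  obtain p where p: "polynomial_function p" "\<And>z. z \<in> sphere 0 1 \<Longrightarrow> norm (G z - p z) < \<epsilon>"
    using Stone_Weierstrass_polynomial_function[OF compact_sphere G(1) \<epsilon>] by blast
  obtain m P where P: "\<And>\<theta>. p (cis \<theta>) = cis (- (real m * \<theta>)) * poly P (cis \<theta>)"
    using polynomial_function_cis[OF p(1)] by blast
  \<comment> \<open>The factor \<open>cis (- (real m * \<theta>))\<close> shifts the exponents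
    \<open>0..degree P\<close> down by \<open>m\<close>; the definition of \<open>a\<close> undoes
    the shift.\<close>
  define F where "F = (\<lambda>k. int k - int m) ` {..degree P}"
  define a where "a n = coeff P (nat (n + int m))" for n
  have "norm (g x - (\<Sum>n\<in>F. a n * trig L n x)) < \<epsilon>" if x: "x \<in> {- L / 2..L / 2}" for x
  proof -
    define \<theta> where "\<theta> = 2 * pi * x / L"
    have "p (cis \<theta>) = (\<Sum>k\<le>degree P. coeff P k * (cis (real k * \<theta>) * cis (- (real m * \<theta>))))"
      by (simp add: P poly_altdef sum_distrib_left Complex.DeMoivre mult_ac)
    also have "\<dots> = (\<Sum>k\<le>degree P. a (int k - int m) * trig L (int k - int m) x)"
      by (intro sum.cong) (auto simp: a_def trig_def cis_mult \<theta>_def ring_distribs diff_divide_distrib mult_ac)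
    also have "\<dots> = (\<Sum>n\<in>F. a n * trig L n x)"
      unfolding F_def by (subst sum.reindex) (auto simp: inj_on_def)
    finally show ?thesis using p(2)[of "cis \<theta>"] G(2)[OF x] by (simp add: \<theta>_def)
  qed
  moreover have "finite F" by (simp add: F_def)
  ultimately show thesis using that by blast
qed

text \<open>The weight serves two purposes: \<open>e = 1\<close> gives the factor 2 in approximation
  estimates, and letting \<open>e\<close> tend to 0 makes comparisons of norms sharp.\<close>

lemma norm_add_square_le:
  fixes a b :: "'a::real_normed_vector"
  assumes "e > 0"
  shows "(norm (a + b))\<^sup>2 \<le> (1 + e) * (norm a)\<^sup>2 + (1 + 1 / e) * (norm b)\<^sup>2"
proof -
  have "(norm (a + b))\<^sup>2 \<le> (norm a + norm b)\<^sup>2"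
    by (intro power_mono norm_triangle_ineq) simp
  also have "\<dots> \<le> (1 + e) * (norm a)\<^sup>2 + (1 + 1 / e) * (norm b)\<^sup>2"
  proof -
    have "0 \<le> (e * norm a - norm b)\<^sup>2 / e" using assms by simp
    also have "\<dots> = e * (norm a)\<^sup>2 + (norm b)\<^sup>2 / e - 2 * norm a * norm b"
      using assms by (simp add: power2_eq_square field_simps)
    finally show ?thesis by (simp add: power2_eq_square algebra_simps)
  qed
  finally show ?thesis .
qed

lemma continuous_on_trig [continuous_intros]: "continuous_on S (trig L n)"
  unfolding trig_def[abs_def] divide_inverse by (intro continuous_intros)

lemma trig_measurable [measurable]: "trig L n \<in> borel_measurable borel"
  by (intro borel_measurable_continuous_onI continuous_intros)

lemma norm_trig [simp]: "norm (trig L n x) = 1"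
  by (simp add: trig_def)

lemma trig_0 [simp]: "trig L 0 x = 1"
  by (simp add: trig_def)

lemma cnj_trig: "cnj (trig L n x) = trig L (- n) x"
  by (simp add: trig_def cis_cnj)

lemma trig_mult: "trig L m x * trig L n x = trig L (m + n) x"
  by (simp add: trig_def cis_mult add_divide_distrib ring_distribs)

text \<open>Orthogonality of the characters: for nonzero \<open>n\<close> the antiderivative has
  period \<open>L\<close>, so its endpoint values cancel.\<close>

lemma set_integral_trig:
  assumes "L > 0"
  shows "(LINT x:{- L / 2..L / 2}|lborel. trig L n x) = (if n = 0 then of_real L else 0)"
proof (cases "n = 0")
  case True
  then show ?thesis using assms by (simp add: set_lebesgue_integral_def scaleR_conv_of_real)
next
  case False
  define w where "w = 2 * pi * of_int n / L"
  have w: "w \<noteq> 0" using False assms by (simp add: w_def)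
  have "((\<lambda>x. cis (w * x) / (\<i> * w)) has_vector_derivative trig L n x) (at x within {- L / 2..L / 2})" for x
  proof -
    have "((\<lambda>z. exp (\<i> * w * z) / (\<i> * w)) has_field_derivative exp (\<i> * w * of_real x)) (at (of_real x))"
      using w by (auto intro!: derivative_eq_intros)
    from has_vector_derivative_real_field[OF this]
    show ?thesis
      by (simp add: trig_def cis_conv_exp w_def mult_ac has_vector_derivative_at_within)
  qed
  then have "(LINT x:{- L / 2..L / 2}|lborel. trig L n x)
      = cis (w * (L / 2)) / (\<i> * w) - cis (w * (- L / 2)) / (\<i> * w)"
    unfolding set_lebesgue_integral_def using assms
    by (intro integral_FTC_atLeastAtMost continuous_intros) auto
  also have "cis (w * (L / 2)) = cis (w * (- L / 2)) * cis (2 * pi * of_int n)"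
  proof -
    have "w * (L / 2) = w * (- L / 2) + 2 * pi * of_int n" using assms by (simp add: w_def)
    then show ?thesis by (simp only: cis_mult)
  qed
  also have "cis (2 * pi * of_int n) = 1"
    by (simp add: cis_multiple_2pi)
  finally show ?thesis using False by simp
qed

text \<open>Measurable functions are almost everywhere limits of continuous ones. Once these are
  clipped at modulus \<open>B\<close> and cut off to vanish at the endpoints, dominated convergence
  and the uniform approximation of periodic functions apply.\<close>

lemma trig_dense_bounded:
  fixes f :: "real \<Rightarrow> complex"
  assumes L: "L > 0" and f[measurable]: "f \<in> borel_measurable borel"
    and B: "\<And>x. norm (f x) \<le> B" and \<epsilon>: "\<epsilon> > 0"
  obtains F a where "finite F"
    "(LINT x:{- L / 2..L / 2}|lborel. (norm (f x - (\<Sum>n\<in>F. a n * trig L n x)))\<^sup>2) < \<epsilon>"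
proof -
  define I where "I = {- L / 2..L / 2}"
  have I[measurable]: "I \<in> sets borel" by (simp add: I_def)
  have emI: "emeasure lborel I = L" using L by (simp add: I_def)
  have B0: "0 \<le> B" using B[of 0] norm_ge_zero order_trans by blast
  have "f measurable_on UNIV"
    by (intro lebesgue_measurable_imp_measurable_on) (auto intro: measurable_completion)
  then obtain N g where N: "negligible N" and g: "\<And>n. continuous_on UNIV (g n)"
    and lim: "\<And>x. x \<notin> N \<Longrightarrow> (\<lambda>n. g n x) \<longlonglongrightarrow> f x"
    unfolding measurable_on_def by auto
  \<comment> \<open>The exceptional set is only Lebesgue negligible; a Borel null set around it is
    needed for statements about \<open>lborel\<close>.\<close>
  obtain N' where N': "N' \<in> null_sets lborel" "N \<subseteq> N'"
    using N unfolding negligible_iff_null_sets null_sets_completion_iff2 by auto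
  \<comment> \<open>The scalar factor vanishes at both endpoints and tends to 1 in the interior, so
    the endpoint values agree; the projection onto the ball supplies the bound
    \<open>B\<close>.\<close>
  define h where "h n x = max 0 (min 1 (real n * (L / 2 - \<bar>x\<bar>))) *\<^sub>R closest_point (cball 0 B) (g n x)" for n x
  have proj: "continuous_on UNIV (closest_point (cball (0::complex) B))"
    using B0 by (intro continuous_on_closest_point) auto
  have projB: "norm (closest_point (cball (0::complex) B) z) \<le> B" for z
    using closest_point_in_set[of "cball (0::complex) B" z] B0 by (simp add: dist_norm)
  have hc: "continuous_on UNIV (h n)" for n
    unfolding h_def by (intro continuous_intros continuous_on_compose2[OF proj g]) auto
  have hm[measurable]: "h n \<in> borel_measurable borel" for n
    using hc by (rule borel_measurable_continuous_onI)
  have hB: "norm (h n x) \<le> B" for n x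
  proof -
    have "norm (h n x) \<le> 1 * norm (closest_point (cball (0::complex) B) (g n x))"
      unfolding h_def norm_scaleR by (intro mult_right_mono) auto
    with projB[of "g n x"] show ?thesis by simp
  qed
  have hlim: "(\<lambda>n. h n x) \<longlonglongrightarrow> f x" if "x \<notin> N'" "\<bar>x\<bar> < L / 2" for x
  proof -
    have "(\<lambda>n. closest_point (cball 0 B) (g n x)) \<longlonglongrightarrow> closest_point (cball 0 B) (f x)"
      by (rule continuous_on_tendsto_compose[OF proj]) (use lim that N' in auto)
    then have c: "(\<lambda>n. closest_point (cball 0 B) (g n x)) \<longlonglongrightarrow> f x"
      using closest_point_self[of "f x" "cball 0 B"] B[of x] by simp
    obtain k where k: "1 / (L / 2 - \<bar>x\<bar>) < real k" using reals_Archimedean2 by blast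
    have "\<forall>\<^sub>F n in sequentially. h n x = closest_point (cball 0 B) (g n x)"
      using eventually_ge_at_top[of k]
    proof eventually_elim
      case (elim n)
      then have "1 / (L / 2 - \<bar>x\<bar>) < real n" using k by simp
      then have "1 < real n * (L / 2 - \<bar>x\<bar>)" using that by (simp add: field_simps)
      then show ?case by (simp add: h_def)
    qed
    then show ?thesis using c tendsto_cong by force
  qed
  have dom: "indicator I x * (norm (f x - h n x))\<^sup>2 \<le> indicator I x * (2 * B)\<^sup>2" for n x
  proof -
    have "norm (f x - h n x) \<le> 2 * B"
      using norm_triangle_ineq4[of "f x" "h n x"] B[of x] hB[of n x] by linarith
    then have "(norm (f x - h n x))\<^sup>2 \<le> (2 * B)\<^sup>2" by (intro power_mono) auto
    then show ?thesis by (auto simp: indicator_def)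
  qed
  have dom_int: "integrable lborel (\<lambda>x. indicator I x * (2 * B)\<^sup>2)"
    using emI by (auto intro!: integrable_mult_left integrable_real_indicator)
  have "(\<lambda>n. LINT x|lborel. indicator I x * (norm (f x - h n x))\<^sup>2) \<longlonglongrightarrow> (LINT x::real|lborel. (0::real))"
  proof (rule integral_dominated_convergence[where w = "\<lambda>x. indicator I x * (2 * B)\<^sup>2"])
    show "integrable lborel (\<lambda>x. indicator I x * (2 * B)\<^sup>2)" by (rule dom_int)
    have "AE x in lborel. x \<notin> N' \<and> x \<notin> {- L / 2, L / 2}"
      using AE_not_in[OF N'(1)] AE_lborel_singleton[of "- L / 2"] AE_lborel_singleton[of "L / 2"]
      by eventually_elim auto
    then show "AE x in lborel. (\<lambda>n. indicator I x * (norm (f x - h n x))\<^sup>2) \<longlonglongrightarrow> 0"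
    proof eventually_elim
      case (elim x)
      show ?case
      proof (cases "x \<in> I")
        case True
        then have "\<bar>x\<bar> < L / 2" using elim by (auto simp: I_def)
        from hlim[OF _ this] elim have "(\<lambda>n. h n x) \<longlonglongrightarrow> f x" by auto
        then have "(\<lambda>n. (norm (f x - h n x))\<^sup>2) \<longlonglongrightarrow> (norm (f x - f x))\<^sup>2"
          by (intro tendsto_intros)
        then show ?thesis using True by simp
      qed simp
    qed
    show "AE x in lborel. norm (indicator I x * (norm (f x - h n x))\<^sup>2) \<le> indicator I x * (2 * B)\<^sup>2" for n
      using dom by auto
  qed auto
  then have "\<forall>\<^sub>F n in sequentially. (LINT x|lborel. indicator I x * (norm (f x - h n x))\<^sup>2) < \<epsilon> / 4"
    by (rule order_tendstoD) (use \<epsilon> in auto)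
  then obtain n where n: "(LINT x|lborel. indicator I x * (norm (f x - h n x))\<^sup>2) < \<epsilon> / 4"
    by (auto simp: eventually_sequentially)
  \<comment> \<open>With this \<open>\<delta>\<close> the uniform error contributes
    \<open>2 * \<delta>\<^sup>2 * L = \<epsilon> / 2\<close>; the other half is spent on the
    distance from \<open>f\<close> to \<open>h n\<close>.\<close>
  define \<delta> where "\<delta> = sqrt (\<epsilon> / (4 * L))"
  have \<delta>: "\<delta> > 0" "\<delta>\<^sup>2 = \<epsilon> / (4 * L)" using L \<epsilon> by (auto simp: \<delta>_def)
  have "continuous_on {- L / 2..L / 2} (h n)" using hc continuous_on_subset by blast
  moreover have "h n (- L / 2) = h n (L / 2)" using L by (simp add: h_def)
  ultimately obtain F a where F: "finite F"
    and a: "\<And>x. x \<in> I \<Longrightarrow> norm (h n x - (\<Sum>n\<in>F. a n * trig L n x)) < \<delta>"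
    using trig_approx_continuous[OF L, of "h n" \<delta>] \<delta>(1) unfolding I_def by blast
  let ?p = "\<lambda>x. \<Sum>n\<in>F. a n * trig L n x"
  have int: "integrable lborel (\<lambda>x. indicator I x * (norm (f x - h n x))\<^sup>2)"
    by (rule Bochner_Integration.integrable_bound[OF dom_int]) (use dom in auto)
  have "(LINT x|lborel. indicator I x * (norm (f x - ?p x))\<^sup>2)
      \<le> (LINT x|lborel. 2 * (indicator I x * (norm (f x - h n x))\<^sup>2) + 2 * \<delta>\<^sup>2 * indicator I x)"
  proof (rule integral_mono')
    show "integrable lborel (\<lambda>x. 2 * (indicator I x * (norm (f x - h n x))\<^sup>2) + 2 * \<delta>\<^sup>2 * indicator I x)"
      using int emI by (auto intro!: integrable_mult_right integrable_real_indicator Bochner_Integration.integrable_add)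
    show "indicator I x * (norm (f x - ?p x))\<^sup>2
        \<le> 2 * (indicator I x * (norm (f x - h n x))\<^sup>2) + 2 * \<delta>\<^sup>2 * indicator I x" for x
    proof (cases "x \<in> I")
      case True
      have "(norm (h n x - ?p x))\<^sup>2 \<le> \<delta>\<^sup>2"
        using a[OF True] by (intro power_mono) auto
      with norm_add_square_le[of 1 "f x - h n x" "h n x - ?p x"] True show ?thesis by simp
    qed simp
  qed auto
  also have "\<dots> = 2 * (LINT x|lborel. indicator I x * (norm (f x - h n x))\<^sup>2) + 2 * \<delta>\<^sup>2 * L"
    using int emI by (subst Bochner_Integration.integral_add)
      (auto intro!: integrable_mult_right integrable_real_indicator simp: measure_def L less_imp_le)
  also have "\<dots> < \<epsilon>" using n \<delta>(2) L by (simp add: field_simps)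
  finally show thesis using that F by (simp add: I_def set_lebesgue_integral_def)
qed

text \<open>The function is replaced by 0 where its modulus exceeds \<open>k\<close>. Dominated
  convergence makes the error small for large \<open>k\<close>, and the bounded case handles the
  rest.\<close>

lemma trig_dense:
  fixes f :: "real \<Rightarrow> complex"
  assumes L: "L > 0" and f[measurable]: "f \<in> borel_measurable borel"
    and f2: "integrable lborel (\<lambda>x. (norm (f x))\<^sup>2)" and \<epsilon>: "\<epsilon> > 0"
  obtains F a where "finite F"
    "(LINT x:{- L / 2..L / 2}|lborel. (norm (f x - (\<Sum>n\<in>F. a n * trig L n x)))\<^sup>2) < \<epsilon>"
proof -
  define I where "I = {- L / 2..L / 2}"
  have I[measurable]: "I \<in> sets borel" by (simp add: I_def)
  define b where "b k x = (if norm (f x) \<le> real k then f x else 0)" for k x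
  have b[measurable]: "b k \<in> borel_measurable borel" for k
    unfolding b_def by measurable
  have le: "(norm (f x - b k x))\<^sup>2 \<le> (norm (f x))\<^sup>2" for k x by (simp add: b_def)
  have int: "integrable lborel (\<lambda>x. (norm (f x - b k x))\<^sup>2)" for k
    by (rule Bochner_Integration.integrable_bound[OF f2]) (use le in auto)
  have "(\<lambda>k. LINT x|lborel. (norm (f x - b k x))\<^sup>2) \<longlonglongrightarrow> (LINT x::real|lborel. (0::real))"
  proof (rule integral_dominated_convergence[OF _ _ f2])
    show "AE x in lborel. (\<lambda>k. (norm (f x - b k x))\<^sup>2) \<longlonglongrightarrow> 0"
    proof (rule AE_I2)
      fix x
      obtain m where "norm (f x) \<le> real m" using real_arch_simple by blast
      then have "\<forall>\<^sub>F k in sequentially. (norm (f x - b k x))\<^sup>2 = 0"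
        by (intro eventually_sequentiallyI[of m]) (auto simp: b_def)
      then show "(\<lambda>k. (norm (f x - b k x))\<^sup>2) \<longlonglongrightarrow> 0" by (rule tendsto_eventually)
    qed
  qed (use le in auto)
  then have "\<forall>\<^sub>F k in sequentially. (LINT x|lborel. (norm (f x - b k x))\<^sup>2) < \<epsilon> / 4"
    by (rule order_tendstoD) (use \<epsilon> in auto)
  then obtain k where k: "(LINT x|lborel. (norm (f x - b k x))\<^sup>2) < \<epsilon> / 4"
    by (auto simp: eventually_sequentially)
  obtain F a where F: "finite F" and
    a: "(LINT x:I|lborel. (norm (b k x - (\<Sum>n\<in>F. a n * trig L n x)))\<^sup>2) < \<epsilon> / 4"
    using trig_dense_bounded[OF L b, of k "real k" "\<epsilon> / 4"] \<epsilon> unfolding I_def by (force simp: b_def)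
  let ?p = "\<lambda>x. \<Sum>n\<in>F. a n * trig L n x"
  \<comment> \<open>Needed to split the integral of the sum below, since a function that is not
    integrable has Bochner integral 0.\<close>
  have int2: "integrable lborel (\<lambda>x. indicator I x * (norm (b k x - ?p x))\<^sup>2)"
  proof (rule Bochner_Integration.integrable_bound)
    define C where "C = real k + (\<Sum>n\<in>F. norm (a n))"
    show "integrable lborel (\<lambda>x. indicator I x * C\<^sup>2)"
      using L by (auto intro!: integrable_mult_left integrable_real_indicator simp: I_def)
    have "norm (b k x - ?p x) \<le> C" for x
    proof -
      have "norm (?p x) \<le> (\<Sum>n\<in>F. norm (a n))"
        by (rule order_trans[OF norm_sum]) (simp add: norm_mult)
      moreover have "norm (b k x) \<le> real k" by (simp add: b_def)
      ultimately show ?thesis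
        using norm_triangle_ineq4[of "b k x" "?p x"] unfolding C_def by linarith
    qed
    then show "AE x in lborel. norm (indicator I x * (norm (b k x - ?p x))\<^sup>2) \<le> norm (indicator I x * C\<^sup>2)"
      by (auto simp: indicator_def intro!: power_mono)
  qed auto
  have "(LINT x|lborel. indicator I x * (norm (f x - ?p x))\<^sup>2)
      \<le> (LINT x|lborel. 2 * (norm (f x - b k x))\<^sup>2 + 2 * (indicator I x * (norm (b k x - ?p x))\<^sup>2))"
  proof (rule integral_mono')
    show "integrable lborel (\<lambda>x. 2 * (norm (f x - b k x))\<^sup>2 + 2 * (indicator I x * (norm (b k x - ?p x))\<^sup>2))"
      using int int2 by auto
    show "indicator I x * (norm (f x - ?p x))\<^sup>2
      \<le> 2 * (norm (f x - b k x))\<^sup>2 + 2 * (indicator I x * (norm (b k x - ?p x))\<^sup>2)" for x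
      using norm_add_square_le[of 1 "f x - b k x" "b k x - ?p x"] by (auto simp: indicator_def)
  qed auto
  also have "\<dots> = 2 * (LINT x|lborel. (norm (f x - b k x))\<^sup>2)
      + 2 * (LINT x|lborel. (indicator I x * (norm (b k x - ?p x))\<^sup>2))"
    using int int2 by simp
  also have "\<dots> < \<epsilon>" using k a by (simp add: set_lebesgue_integral_def)
  finally show thesis using that F by (simp add: I_def set_lebesgue_integral_def)
qed

section \<open>The identities of Parseval and Plancherel\<close>

text \<open>The bound \<open>norm (f x) \<le> 1 + (norm (f x))\<^sup>2\<close> suffices on a bounded
  interval. It makes the Fourier coefficients genuine integrals rather than default values.\<close>

lemma integrable_of_square_integrable:
  fixes f :: "real \<Rightarrow> complex"
  assumes [measurable]: "f \<in> borel_measurable borel" and f2: "integrable lborel (\<lambda>x. (norm (f x))\<^sup>2)"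
    and supp: "\<And>x. x \<notin> {a..b} \<Longrightarrow> f x = 0"
  shows "integrable lborel f"
proof (rule Bochner_Integration.integrable_bound)
  show "integrable lborel (\<lambda>x. indicator {a..b} x + (norm (f x))\<^sup>2)"
    using f2 by (intro Bochner_Integration.integrable_add integrable_real_indicator) (auto simp: emeasure_lborel_Icc_eq)
  have "norm (f x) \<le> indicator {a..b} x + (norm (f x))\<^sup>2" for x
  proof (cases "x \<in> {a..b}")
    case True
    have "0 \<le> (norm (f x) - 1 / 2)\<^sup>2" by simp
    then have "norm (f x) \<le> 1 + (norm (f x))\<^sup>2" by (simp add: power2_eq_square algebra_simps)
    then show ?thesis using True by simp
  qed (simp add: supp)
  then show "AE x in lborel. norm (f x) \<le> norm (indicator {a..b} x + (norm (f x))\<^sup>2)"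
    by (auto intro!: AE_I2 order_trans[OF _ abs_ge_self])
qed simp

text \<open>Completing the square in the coefficients. The choice \<open>a n = c n / L\<close> gives
  Bessel's inequality, while any good approximation bounds the sum of the
  \<open>(norm (c n))\<^sup>2\<close> from below.\<close>

lemma trig_least_squares:
  fixes f :: "real \<Rightarrow> complex"
  assumes L: "L > 0" and f[measurable]: "f \<in> borel_measurable borel"
    and f2: "integrable lborel (\<lambda>x. (norm (f x))\<^sup>2)"
    and supp: "\<And>x. x \<notin> {- L / 2..L / 2} \<Longrightarrow> f x = 0"
    and F: "finite F"
  defines "c \<equiv> \<lambda>n. LINT x|lborel. f x * trig L (- n) x"
  shows "(LINT x:{- L / 2..L / 2}|lborel. (norm (f x - (\<Sum>n\<in>F. a n * trig L n x)))\<^sup>2)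
    = (LINT x|lborel. (norm (f x))\<^sup>2) - (\<Sum>n\<in>F. (norm (c n))\<^sup>2) / L + L * (\<Sum>n\<in>F. (norm (a n - c n / L))\<^sup>2)"
proof -
  define I where "I = {- L / 2..L / 2}"
  have [measurable]: "I \<in> sets borel" by (simp add: I_def)
  have fint: "integrable lborel f"
    using integrable_of_square_integrable[OF f f2 supp] by blast
  have ft: "integrable lborel (\<lambda>x. f x * trig L n x)" for n
    by (rule Bochner_Integration.integrable_bound[OF fint]) (auto simp: norm_mult)
  have It: "integrable lborel (\<lambda>x. indicator I x *\<^sub>R trig L n x)" for n
  proof (rule Bochner_Integration.integrable_bound)
    show "integrable lborel (indicator I :: real \<Rightarrow> real)"
      by (intro integrable_real_indicator) (auto simp: emeasure_lborel_Icc_eq I_def)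
  qed (auto simp: indicator_def)
  let ?p = "\<lambda>x. \<Sum>n\<in>F. a n * trig L n x"
  \<comment> \<open>Outside \<open>I\<close> both sides vanish: \<open>f\<close> is 0 there, so on
    the right only the purely trigonometric term needs the indicator.\<close>
  have expand: "complex_of_real (indicator I x * (norm (f x - ?p x))\<^sup>2) = of_real ((norm (f x))\<^sup>2)
      - (\<Sum>n\<in>F. cnj (a n) * (f x * trig L (- n) x)) - cnj (\<Sum>n\<in>F. cnj (a n) * (f x * trig L (- n) x))
      + (\<Sum>m\<in>F. \<Sum>n\<in>F. a m * cnj (a n) * (indicator I x *\<^sub>R trig L (m - n) x))" for x
  proof (cases "x \<in> I")
    case True
    have "complex_of_real ((norm (f x - ?p x))\<^sup>2) = (f x - ?p x) * cnj (f x - ?p x)"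
      by (rule complex_norm_square)
    also have "\<dots> = f x * cnj (f x) - f x * cnj (?p x) - cnj (f x * cnj (?p x)) + ?p x * cnj (?p x)"
      by (simp add: algebra_simps)
    also have "f x * cnj (?p x) = (\<Sum>n\<in>F. cnj (a n) * (f x * trig L (- n) x))"
      by (simp add: sum_distrib_left cnj_trig mult_ac)
    also have "?p x * cnj (?p x) = (\<Sum>m\<in>F. \<Sum>n\<in>F. a m * cnj (a n) * (trig L m x * trig L (- n) x))"
      by (simp add: sum_product cnj_trig mult_ac)
    finally show ?thesis using True by (simp add: trig_mult flip: complex_norm_square)
  next
    case False
    then have "f x = 0" using supp by (simp add: I_def)
    then show ?thesis using False by simp
  qed
  have i1: "integrable lborel (\<lambda>x. complex_of_real ((norm (f x))\<^sup>2))"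
    using f2 by (intro integrable_of_real)
  have i2: "integrable lborel (\<lambda>x. \<Sum>n\<in>F. cnj (a n) * (f x * trig L (- n) x))"
    using ft by auto
  have i3: "integrable lborel (\<lambda>x. cnj (\<Sum>n\<in>F. cnj (a n) * (f x * trig L (- n) x)))"
    using i2 by (rule integrable_cnj)
  have i4: "integrable lborel (\<lambda>x. \<Sum>m\<in>F. \<Sum>n\<in>F. a m * cnj (a n) * (indicator I x *\<^sub>R trig L (m - n) x))"
    using It by (intro Bochner_Integration.integrable_sum integrable_mult_right)
  have c1: "(LINT x|lborel. (\<Sum>n\<in>F. cnj (a n) * (f x * trig L (- n) x))) = (\<Sum>n\<in>F. cnj (a n) * c n)"
    using ft by (simp add: c_def Bochner_Integration.integral_sum)
  have c2: "(LINT x|lborel. cnj (\<Sum>n\<in>F. cnj (a n) * (f x * trig L (- n) x))) = cnj (\<Sum>n\<in>F. cnj (a n) * c n)"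
    unfolding c1[symmetric] by (rule Bochner_Integration.integral_cnj)
  have "complex_of_real (LINT x|lborel. indicator I x * (norm (f x - ?p x))\<^sup>2)
     = (LINT x|lborel. complex_of_real (indicator I x * (norm (f x - ?p x))\<^sup>2))"
    by (rule integral_complex_of_real[symmetric])
  also have "\<dots> = (LINT x|lborel. complex_of_real ((norm (f x))\<^sup>2))
      - (\<Sum>n\<in>F. cnj (a n) * c n) - cnj (\<Sum>n\<in>F. cnj (a n) * c n)
      + (LINT x|lborel. (\<Sum>m\<in>F. \<Sum>n\<in>F. a m * cnj (a n) * (indicator I x *\<^sub>R trig L (m - n) x)))"
    unfolding expand using i1 i2 i3 i4 c1 c2
    by (simp only: Bochner_Integration.integral_add Bochner_Integration.integral_diff
        Bochner_Integration.integrable_diff Bochner_Integration.integrable_add)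
  also have "(LINT x|lborel. (\<Sum>m\<in>F. \<Sum>n\<in>F. a m * cnj (a n) * (indicator I x *\<^sub>R trig L (m - n) x)))
      = (\<Sum>m\<in>F. \<Sum>n\<in>F. a m * cnj (a n) * (LINT x:I|lborel. trig L (m - n) x))"
    unfolding set_lebesgue_integral_def
    by (simp only: Bochner_Integration.integral_sum Bochner_Integration.integrable_sum
        integrable_mult_right integral_mult_right_zero It)
  also have "\<dots> = (\<Sum>m\<in>F. \<Sum>n\<in>F. if n = m then L * (a m * cnj (a m)) else 0)"
    unfolding I_def set_integral_trig[OF L] by (intro sum.cong refl) auto
  also have "\<dots> = (\<Sum>m\<in>F. L * (a m * cnj (a m)))" using F by simp
  \<comment> \<open>The cross terms are those of \<open>L * (norm (a n - c n / L))\<^sup>2\<close>,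
    whose remaining part \<open>(norm (c n))\<^sup>2 / L\<close> is subtracted again.\<close>
  also have "(LINT x|lborel. complex_of_real ((norm (f x))\<^sup>2)) - (\<Sum>n\<in>F. cnj (a n) * c n)
      - cnj (\<Sum>n\<in>F. cnj (a n) * c n) + (\<Sum>m\<in>F. L * (a m * cnj (a m)))
    = (LINT x|lborel. complex_of_real ((norm (f x))\<^sup>2)) - (\<Sum>n\<in>F. c n * cnj (c n)) / L
      + L * (\<Sum>n\<in>F. (a n - c n / L) * cnj (a n - c n / L))"
    using L by (simp add: sum_distrib_left sum_divide_distrib algebra_simps sum.distrib sum_subtractf)
  also have "\<dots> = complex_of_real ((LINT x|lborel. (norm (f x))\<^sup>2) - (\<Sum>n\<in>F. (norm (c n))\<^sup>2) / L
      + L * (\<Sum>n\<in>F. (norm (a n - c n / L))\<^sup>2))"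
    by (simp only: integral_complex_of_real of_real_diff of_real_add of_real_mult of_real_divide of_real_sum)
       (simp only: complex_norm_square)
  finally show ?thesis
    unfolding of_real_eq_iff by (simp add: I_def set_lebesgue_integral_def)
qed

text \<open>The factor \<open>L\<close> appears because the characters are not normalised. Both
  sides are extended nonnegative integrals, so that the identity can be integrated over cosets and
  slices by Tonelli's theorem.\<close>

theorem parseval:
  fixes f :: "real \<Rightarrow> complex"
  assumes L: "L > 0" and f[measurable]: "f \<in> borel_measurable borel"
    and f2: "integrable lborel (\<lambda>x. (norm (f x))\<^sup>2)"
    and supp: "\<And>x. x \<notin> {- L / 2..L / 2} \<Longrightarrow> f x = 0"
  shows "(\<integral>\<^sup>+n. (norm (LINT x|lborel. f x * trig L n x))\<^sup>2 \<partial>count_space UNIV)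
    = ennreal L * (\<integral>\<^sup>+x. (norm (f x))\<^sup>2 \<partial>lborel)"
proof -
  define c where "c n = (LINT x|lborel. f x * trig L (- n) x)" for n
  define S where "S = (LINT x|lborel. (norm (f x))\<^sup>2)"
  have ls: "(LINT x:{- L / 2..L / 2}|lborel. (norm (f x - (\<Sum>n\<in>F. a n * trig L n x)))\<^sup>2)
    = S - (\<Sum>n\<in>F. (norm (c n))\<^sup>2) / L + L * (\<Sum>n\<in>F. (norm (a n - c n / L))\<^sup>2)"
    if "finite F" for F a
    using trig_least_squares[OF L f f2 supp that] unfolding c_def S_def by blast
  have bessel: "(\<Sum>n\<in>F. (norm (c n))\<^sup>2) \<le> L * S" if "finite F" for F
  proof -
    have "0 \<le> S - (\<Sum>n\<in>F. (norm (c n))\<^sup>2) / L + L * (\<Sum>n\<in>F. (norm (c n / L - c n / L))\<^sup>2)"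
      unfolding ls[OF that, symmetric] set_lebesgue_integral_def by (rule integral_nonneg_AE) auto
    then show ?thesis using L by (simp add: field_simps)
  qed
  have "((\<lambda>n. (norm (c n))\<^sup>2) has_sum (L * S)) UNIV"
    unfolding has_sum_def tendsto_iff eventually_finite_subsets_at_top
  proof safe
    fix e :: real assume "e > 0"
    then have "e / L > 0" using L by simp
    then obtain F a where F: "finite F"
      "(LINT x:{- L / 2..L / 2}|lborel. (norm (f x - (\<Sum>n\<in>F. a n * trig L n x)))\<^sup>2) < e / L"
      using trig_dense[OF L f f2] by blast
    \<comment> \<open>Dropping this nonnegative term turns the small approximation error into a
      lower bound for the coefficient sum over \<open>F\<close>; \<open>bessel\<close> is the
      matching upper bound for all larger index sets.\<close>
    have "0 \<le> L * (\<Sum>n\<in>F. (norm (a n - c n / L))\<^sup>2)" using L by (simp add: sum_nonneg)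
    then have "S - (\<Sum>n\<in>F. (norm (c n))\<^sup>2) / L < e / L" using F(2) ls[OF F(1)] by simp
    from mult_strict_left_mono[OF this L]
    have *: "L * S - e < (\<Sum>n\<in>F. (norm (c n))\<^sup>2)" using L by (simp add: right_diff_distrib)
    have "dist (\<Sum>n\<in>Y. (norm (c n))\<^sup>2) (L * S) < e" if "finite Y" "F \<subseteq> Y" for Y
      using * bessel[OF that(1)] sum_mono2[OF that, of "\<lambda>n. (norm (c n))\<^sup>2"]
      by (auto simp: dist_real_def)
    then show "\<exists>X. finite X \<and> X \<subseteq> UNIV \<and> (\<forall>Y. finite Y \<and> X \<subseteq> Y \<and> Y \<subseteq> UNIV
        \<longrightarrow> dist (\<Sum>n\<in>Y. (norm (c n))\<^sup>2) (L * S) < e)"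
      using F(1) by auto
  qed
  then have inf: "infsum (\<lambda>n. (norm (c n))\<^sup>2) UNIV = L * S"
    and summ: "(\<lambda>n. (norm (c n))\<^sup>2) summable_on UNIV"
    by (auto simp: infsumI summable_on_def)
  have abs: "Infinite_Set_Sum.abs_summable_on (\<lambda>n. (norm (c n))\<^sup>2) UNIV"
    using summ by (subst abs_summable_equivalent[symmetric]) simp
  have "(\<integral>\<^sup>+n. (norm (LINT x|lborel. f x * trig L n x))\<^sup>2 \<partial>count_space UNIV)
      = (\<integral>\<^sup>+n. (norm (c (- n)))\<^sup>2 \<partial>count_space UNIV)"
    by (simp add: c_def)
  \<comment> \<open>\<open>c\<close> is defined with the conjugate characters; the sum over all
    integers is invariant under \<open>n \<mapsto> - n\<close>.\<close>
  also have "\<dots> = (\<integral>\<^sup>+n. (norm (c n))\<^sup>2 \<partial>count_space UNIV)"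
    by (rule nn_integral_bij_count_space) (auto intro!: bij_uminus)
  also have "\<dots> = ennreal (L * S)"
    using nn_integral_conv_infsetsum[OF abs] infsetsum_infsum[OF abs] inf by simp
  also have "\<dots> = ennreal L * (\<integral>\<^sup>+x. (norm (f x))\<^sup>2 \<partial>lborel)"
    using L nn_integral_eq_integral[OF f2] by (simp add: S_def ennreal_mult)
  finally show ?thesis .
qed

text \<open>The half-open cells of length \<open>d\<close> partition the line, and each is
  translated back to \<open>{0..<d}\<close>.\<close>

lemma nn_integral_lborel_tile:
  fixes \<phi> :: "real \<Rightarrow> ennreal"
  assumes d: "d > 0" and [measurable]: "\<phi> \<in> borel_measurable borel"
  shows "(\<integral>\<^sup>+x. \<phi> x \<partial>lborel)
    = (\<integral>\<^sup>+x. (\<integral>\<^sup>+n. \<phi> (x + of_int n * d) \<partial>count_space UNIV) * indicator {0..<d} x \<partial>lborel)"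
proof -
  have one: "(\<integral>\<^sup>+n. indicator {of_int n * d..<of_int n * d + d} x \<partial>count_space UNIV) = (1::ennreal)" for x
  proof -
    have iff: "x \<in> {of_int n * d..<of_int n * d + d} \<longleftrightarrow> n = \<lfloor>x / d\<rfloor>" for n
      using d by (auto simp: eq_commute[of n] floor_eq_iff field_simps)
    have "(\<integral>\<^sup>+n. indicator {of_int n * d..<of_int n * d + d} x \<partial>count_space UNIV)
        = (\<integral>\<^sup>+n. indicator {\<lfloor>x / d\<rfloor>} n \<partial>count_space UNIV)"
      by (intro nn_integral_cong) (use iff in \<open>auto simp: indicator_def simp del: atLeastLessThan_iff\<close>)
    then show ?thesis by simp
  qed
  have "(\<integral>\<^sup>+x. \<phi> x \<partial>lborel)
      = (\<integral>\<^sup>+x. (\<integral>\<^sup>+n. \<phi> x * indicator {of_int n * d..<of_int n * d + d} x \<partial>count_space UNIV) \<partial>lborel)"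
    by (intro nn_integral_cong) (simp add: nn_integral_cmult one)
  also have "\<dots> = (\<integral>\<^sup>+n. (\<integral>\<^sup>+x. \<phi> x * indicator {of_int n * d..<of_int n * d + d} x \<partial>lborel) \<partial>count_space UNIV)"
    by (rule nn_integral_count_space_nn_integral) auto
  also have "\<dots> = (\<integral>\<^sup>+n. (\<integral>\<^sup>+x. \<phi> (x + of_int n * d) * indicator {0..<d} x \<partial>lborel) \<partial>count_space UNIV)"
  proof (rule nn_integral_cong)
    fix n :: int
    show "(\<integral>\<^sup>+x. \<phi> x * indicator {of_int n * d..<of_int n * d + d} x \<partial>lborel)
        = (\<integral>\<^sup>+x. \<phi> (x + of_int n * d) * indicator {0..<d} x \<partial>lborel)"
      by (subst nn_integral_real_affine[where c = 1 and t = "of_int n * d"])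
         (auto intro!: nn_integral_cong simp: indicator_def add.commute)
  qed
  also have "\<dots> = (\<integral>\<^sup>+x. (\<integral>\<^sup>+n. \<phi> (x + of_int n * d) * indicator {0..<d} x \<partial>count_space UNIV) \<partial>lborel)"
    by (rule nn_integral_count_space_nn_integral[symmetric]) auto
  also have "\<dots> = (\<integral>\<^sup>+x. (\<integral>\<^sup>+n. \<phi> (x + of_int n * d) \<partial>count_space UNIV) * indicator {0..<d} x \<partial>lborel)"
    by (simp add: nn_integral_multc)
  finally show ?thesis .
qed

lemma cis_measurable [measurable (raw)]:
  "f \<in> borel_measurable M \<Longrightarrow> (\<lambda>x. cis (f x)) \<in> borel_measurable M"
  by (rule borel_measurable_continuous_on[of cis]) (intro continuous_intros)

lemma cnj_measurable [measurable (raw)]: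
  "f \<in> borel_measurable M \<Longrightarrow> (\<lambda>x. cnj (f x)) \<in> borel_measurable M"
  by (rule borel_measurable_continuous_on[of cnj]) (intro continuous_intros)

lemma plancherel_compact_support:
  fixes f :: "real \<Rightarrow> complex"
  assumes R: "R > 0" and f[measurable]: "f \<in> borel_measurable borel"
    and f2: "integrable lborel (\<lambda>x. (norm (f x))\<^sup>2)"
    and supp: "\<And>x. x \<notin> {- R..R} \<Longrightarrow> f x = 0"
  shows "(\<integral>\<^sup>+\<nu>. (norm (LINT x|lborel. f x * cis (- 2 * pi * x * \<nu>)))\<^sup>2 \<partial>lborel)
    = (\<integral>\<^sup>+x. (norm (f x))\<^sup>2 \<partial>lborel)"
proof -
  define L where "L = 2 * R"
  have L: "L > 0" "L / 2 = R" using R by (auto simp: L_def)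
  define \<phi> where "\<phi> \<nu> = ennreal ((norm (LINT x|lborel. f x * cis (- 2 * pi * x * \<nu>)))\<^sup>2)" for \<nu>
  have [measurable]: "\<phi> \<in> borel_measurable borel" unfolding \<phi>_def by measurable
  define A where "A = (\<integral>\<^sup>+x. (norm (f x))\<^sup>2 \<partial>lborel)"
  have tile: "(\<integral>\<^sup>+n. \<phi> (\<nu> + of_int n * (1 / L)) \<partial>count_space UNIV) = ennreal L * A" for \<nu>
  proof -
    \<comment> \<open>Conjugation turns the negative exponent of the Fourier integral into the
      positive one of \<open>trig\<close>, and the modulation moves the coset of
      \<open>\<nu>\<close> onto the lattice.\<close>
    define g where "g x = cnj (f x) * cis (2 * pi * x * \<nu>)" for x
    have ng: "norm (g x) = norm (f x)" for x by (simp add: g_def norm_mult)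
    have "\<phi> (\<nu> + of_int n * (1 / L)) = (norm (LINT x|lborel. g x * trig L n x))\<^sup>2" for n
    proof -
      have "f x * cis (- 2 * pi * x * (\<nu> + of_int n * (1 / L))) = cnj (g x * trig L n x)" for x
        by (simp add: g_def trig_def cis_cnj cis_mult ring_distribs mult_ac)
      then have "(LINT x|lborel. f x * cis (- 2 * pi * x * (\<nu> + of_int n * (1 / L))))
          = cnj (LINT x|lborel. g x * trig L n x)"
        by (simp only: Bochner_Integration.integral_cnj)
      then show ?thesis by (simp only: \<phi>_def complex_mod_cnj)
    qed
    then have "(\<integral>\<^sup>+n. \<phi> (\<nu> + of_int n * (1 / L)) \<partial>count_space UNIV)
        = (\<integral>\<^sup>+n. (norm (LINT x|lborel. g x * trig L n x))\<^sup>2 \<partial>count_space UNIV)" by simp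
    also have "\<dots> = ennreal L * (\<integral>\<^sup>+x. (norm (g x))\<^sup>2 \<partial>lborel)"
    proof (rule parseval)
      show "integrable lborel (\<lambda>x. (norm (g x))\<^sup>2)" by (simp add: ng f2)
      show "g x = 0" if "x \<notin> {- L / 2..L / 2}" for x
        using supp[of x] that L by (simp add: g_def)
      show "g \<in> borel_measurable borel" unfolding g_def by measurable
    qed fact
    finally show ?thesis by (simp add: ng A_def)
  qed
  have "(\<integral>\<^sup>+\<nu>. \<phi> \<nu> \<partial>lborel) = (\<integral>\<^sup>+\<nu>. ennreal L * A * indicator {0..<1 / L} \<nu> \<partial>lborel)"
    using L nn_integral_lborel_tile[of "1 / L" \<phi>] unfolding tile by simp
  \<comment> \<open>The coset sum does not depend on \<open>\<nu>\<close>, and the length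
    \<open>1 / L\<close> of the cell cancels the factor \<open>L\<close>.\<close>
  also have "\<dots> = ennreal L * A * ennreal (1 / L)"
    using L by (subst nn_integral_cmult_indicator) auto
  also have "\<dots> = ennreal L * ennreal (1 / L) * A" by (simp add: mult_ac)
  also have "\<dots> = A" using L by (simp flip: ennreal_mult)
  finally show ?thesis by (simp add: \<phi>_def A_def)
qed

section \<open>The spreading function\<close>

text \<open>The complement of the support is a union of open sets on which \<open>f\<close> vanishes
  almost everywhere. There may be uncountably many, and the Lindelof property leaves countably many
  null sets.\<close>

lemma AE_zero_outside_ess_supp:
  fixes f :: "'a::euclidean_space \<Rightarrow> complex"
  assumes "ess_supp f \<subseteq> S"
  shows "AE z in lborel. z \<notin> S \<longrightarrow> f z = 0"
proof -
  define \<U> where "\<U> = {U. open U \<and> (AE w in lborel. w \<in> U \<longrightarrow> f w = 0)}"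
  obtain \<V> where \<V>: "\<V> \<subseteq> \<U>" "countable \<V>" "\<Union>\<V> = \<Union>\<U>"
    using Lindelof[of \<U>] unfolding \<U>_def by auto
  have "AE z in lborel. \<forall>U\<in>\<V>. z \<in> U \<longrightarrow> f z = 0"
    using \<V> by (subst AE_ball_countable) (auto simp: \<U>_def)
  then show ?thesis
  proof eventually_elim
    case (elim z)
    show ?case
    proof
      assume "z \<notin> S"
      then have "z \<in> \<Union>\<U>" using assms unfolding ess_supp_def \<U>_def by blast
      then show "f z = 0" using elim \<V>(3) by blast
    qed
  qed
qed

section \<open>Norms and limits in \<open>L2\<close>\<close>

lemma L2_norm_square: "(L2_norm \<mu> f)\<^sup>2 = (\<integral>x. (norm (f x))\<^sup>2 \<partial>\<mu>)"
  by (simp add: L2_norm_def)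

lemma L2_diff:
  assumes f: "f \<in> L2 \<mu>" and g: "g \<in> L2 \<mu>"
  shows "(\<lambda>x. f x - g x) \<in> L2 \<mu>"
proof -
  have [measurable]: "f \<in> borel_measurable \<mu>" "g \<in> borel_measurable \<mu>" using f g by (auto simp: L2_def)
  have "integrable \<mu> (\<lambda>x. (norm (f x - g x))\<^sup>2)"
  proof (rule Bochner_Integration.integrable_bound)
    show "integrable \<mu> (\<lambda>x. 2 * (norm (f x))\<^sup>2 + 2 * (norm (g x))\<^sup>2)"
      using f g by (auto simp: L2_def)
    show "AE x in \<mu>. norm ((norm (f x - g x))\<^sup>2) \<le> norm (2 * (norm (f x))\<^sup>2 + 2 * (norm (g x))\<^sup>2)"
      using norm_add_square_le[of 1 "f x" "- g x" for x] by auto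
  qed measurable
  then show ?thesis by (simp add: L2_def)
qed

text \<open>The weighted inequality is integrated. Membership in \<open>L2\<close> rules out that
  the norms on the right are the default value 0.\<close>

lemma L2_norm_square_le:
  assumes f: "f \<in> L2 \<mu>" and g: "g \<in> L2 \<mu>" and "e > 0"
  shows "(L2_norm \<mu> f)\<^sup>2 \<le> (1 + e) * (L2_norm \<mu> g)\<^sup>2 + (1 + 1 / e) * (L2_norm \<mu> (\<lambda>x. f x - g x))\<^sup>2"
proof -
  have i: "integrable \<mu> (\<lambda>x. (norm (g x))\<^sup>2)" "integrable \<mu> (\<lambda>x. (norm (f x - g x))\<^sup>2)"
    using g L2_diff[OF f g] by (auto simp: L2_def)
  have "(\<integral>x. (norm (f x))\<^sup>2 \<partial>\<mu>) \<le> (\<integral>x. (1 + e) * (norm (g x))\<^sup>2 + (1 + 1 / e) * (norm (f x - g x))\<^sup>2 \<partial>\<mu>)"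
    using norm_add_square_le[OF \<open>e > 0\<close>, of "g x" "f x - g x" for x] i f
    by (intro integral_mono) (auto simp: L2_def)
  also have "\<dots> = (1 + e) * (\<integral>x. (norm (g x))\<^sup>2 \<partial>\<mu>) + (1 + 1 / e) * (\<integral>x. (norm (f x - g x))\<^sup>2 \<partial>\<mu>)"
    using i by simp
  finally show ?thesis by (simp add: L2_norm_square)
qed

lemma le_of_le_scaled:
  fixes a b :: real
  assumes "\<And>e. e > 0 \<Longrightarrow> a \<le> (1 + e) * b"
  shows "a \<le> b"
proof (rule tendsto_lowerbound)
  have "((\<lambda>e. (1 + e) * b) \<longlongrightarrow> (1 + 0) * b) (at_right 0)" by (intro tendsto_intros)
  then show "((\<lambda>e. (1 + e) * b) \<longlongrightarrow> b) (at_right 0)" by simp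
  show "\<forall>\<^sub>F e in at_right 0. a \<le> (1 + e) * b"
    using assms by (auto simp: eventually_at_right_field intro: exI[of _ 1])
qed simp

text \<open>Continuity of the norm by a comparison in both directions: for fixed \<open>e\<close>
  the term with \<open>1 + 1 / e\<close> disappears in the limit, and then \<open>e\<close> tends to
  0. Eventual membership in \<open>L2\<close> fits truncations, which are controlled for positive
  radii.\<close>

lemma L2_norm_square_limit:
  assumes g: "g \<in> L2 \<mu>" and f: "\<forall>\<^sub>F r in F. f r \<in> L2 \<mu>" and F: "F \<noteq> bot"
    and lim: "((\<lambda>r. L2_norm \<mu> (\<lambda>x. g x - f r x)) \<longlongrightarrow> 0) F"
    and S: "((\<lambda>r. (L2_norm \<mu> (f r))\<^sup>2) \<longlongrightarrow> S) F"
  shows "(L2_norm \<mu> g)\<^sup>2 = S"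
proof (rule antisym)
  have lim2: "((\<lambda>r. (L2_norm \<mu> (\<lambda>x. g x - f r x))\<^sup>2) \<longlongrightarrow> 0) F"
    using tendsto_power[OF lim, of 2] by simp
  show "(L2_norm \<mu> g)\<^sup>2 \<le> S"
  proof (rule le_of_le_scaled, rule tendsto_lowerbound[OF _ _ F])
    fix e :: real assume e: "e > 0"
    have "((\<lambda>r. (1 + e) * (L2_norm \<mu> (f r))\<^sup>2 + (1 + 1 / e) * (L2_norm \<mu> (\<lambda>x. g x - f r x))\<^sup>2)
        \<longlongrightarrow> (1 + e) * S + (1 + 1 / e) * 0) F"
      by (intro tendsto_intros S lim2)
    then show "((\<lambda>r. (1 + e) * (L2_norm \<mu> (f r))\<^sup>2 + (1 + 1 / e) * (L2_norm \<mu> (\<lambda>x. g x - f r x))\<^sup>2)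
        \<longlongrightarrow> (1 + e) * S) F" by simp
    show "\<forall>\<^sub>F r in F. (L2_norm \<mu> g)\<^sup>2
        \<le> (1 + e) * (L2_norm \<mu> (f r))\<^sup>2 + (1 + 1 / e) * (L2_norm \<mu> (\<lambda>x. g x - f r x))\<^sup>2"
      using f by eventually_elim (rule L2_norm_square_le[OF g _ e])
  qed
  show "S \<le> (L2_norm \<mu> g)\<^sup>2"
  proof (rule le_of_le_scaled, rule tendsto_le[OF F _ S])
    fix e :: real assume e: "e > 0"
    have "((\<lambda>r. (1 + e) * (L2_norm \<mu> g)\<^sup>2 + (1 + 1 / e) * (L2_norm \<mu> (\<lambda>x. g x - f r x))\<^sup>2)
        \<longlongrightarrow> (1 + e) * (L2_norm \<mu> g)\<^sup>2 + (1 + 1 / e) * 0) F"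
      by (intro tendsto_intros lim2)
    then show "((\<lambda>r. (1 + e) * (L2_norm \<mu> g)\<^sup>2 + (1 + 1 / e) * (L2_norm \<mu> (\<lambda>x. g x - f r x))\<^sup>2)
        \<longlongrightarrow> (1 + e) * (L2_norm \<mu> g)\<^sup>2) F" by simp
    show "\<forall>\<^sub>F r in F. (L2_norm \<mu> (f r))\<^sup>2
        \<le> (1 + e) * (L2_norm \<mu> g)\<^sup>2 + (1 + 1 / e) * (L2_norm \<mu> (\<lambda>x. g x - f r x))\<^sup>2"
      using f
    proof eventually_elim
      case (elim r)
      have "L2_norm \<mu> (\<lambda>x. f r x - g x) = L2_norm \<mu> (\<lambda>x. g x - f r x)"
        by (simp add: L2_norm_def norm_minus_commute)
      then show ?case using L2_norm_square_le[OF elim g e] by simp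
    qed
  qed
qed

text \<open>The functions \<open>f r - g'\<close> converge to \<open>g - g'\<close> while their
  norms tend to 0, so continuity of the norm makes \<open>g - g'\<close> a null function.\<close>

lemma L2_limit_unique:
  assumes g: "g \<in> L2 \<mu>" and g': "g' \<in> L2 \<mu>" and f: "\<forall>\<^sub>F r in F. f r \<in> L2 \<mu>" and F: "F \<noteq> bot"
    and lim: "((\<lambda>r. L2_norm \<mu> (\<lambda>x. g x - f r x)) \<longlongrightarrow> 0) F"
    and lim': "((\<lambda>r. L2_norm \<mu> (\<lambda>x. g' x - f r x)) \<longlongrightarrow> 0) F"
  shows "AE x in \<mu>. g x = g' x"
proof -
  have "(L2_norm \<mu> (\<lambda>x. g x - g' x))\<^sup>2 = 0"
  proof (rule L2_norm_square_limit[where f = "\<lambda>r x. f r x - g' x", OF _ _ F])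
    show "(\<lambda>x. g x - g' x) \<in> L2 \<mu>" using g g' by (rule L2_diff)
    show "\<forall>\<^sub>F r in F. (\<lambda>x. f r x - g' x) \<in> L2 \<mu>"
      using f by eventually_elim (rule L2_diff[OF _ g'])
    show "((\<lambda>r. L2_norm \<mu> (\<lambda>x. g x - g' x - (f r x - g' x))) \<longlongrightarrow> 0) F" using lim by simp
    have "((\<lambda>r. (L2_norm \<mu> (\<lambda>x. f r x - g' x))\<^sup>2) \<longlongrightarrow> 0\<^sup>2) F"
      using lim' by (intro tendsto_power) (simp add: L2_norm_def norm_minus_commute)
    then show "((\<lambda>r. (L2_norm \<mu> (\<lambda>x. f r x - g' x))\<^sup>2) \<longlongrightarrow> 0) F" by simp
  qed
  then have "(\<integral>x. (norm (g x - g' x))\<^sup>2 \<partial>\<mu>) = 0" by (simp add: L2_norm_square)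
  then have "AE x in \<mu>. (norm (g x - g' x))\<^sup>2 = 0"
    using L2_diff[OF g g'] by (subst (asm) integral_nonneg_eq_0_iff_AE) (auto simp: L2_def)
  then show ?thesis by simp
qed

section \<open>Truncated Fourier integrals of the impulse response\<close>

definition truncated_spreading :: "operator \<Rightarrow> real \<Rightarrow> real \<times> real \<Rightarrow> complex" where
  "truncated_spreading H R =
     (\<lambda>(t, \<nu>). \<integral>x\<in>{- R..R}. impulse_response H t x * cis (- 2 * pi * x * \<nu>) \<partial>lborel)"

lemma is_spreading_function_iff:
  "is_spreading_function H \<eta> \<longleftrightarrow> \<eta> \<in> L2 lborel \<and>
     ((\<lambda>R. L2_norm lborel (\<lambda>z. \<eta> z - truncated_spreading H R z)) \<longlongrightarrow> 0) at_top"
  by (simp add: is_spreading_function_def truncated_spreading_def case_prod_unfold)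

lemma HS_kernel_L2: "H \<in> HS \<Longrightarrow> HS_kernel H \<in> L2 lborel"
  using someI_ex[of "is_HS_kernel H"] unfolding HS_def HS_kernel_def is_HS_kernel_def by blast

lemma borel_measurable_lborel_pair_iff:
  "(f :: real \<times> real \<Rightarrow> complex) \<in> borel_measurable lborel \<longleftrightarrow> f \<in> borel_measurable (borel \<Otimes>\<^sub>M borel)"
  by (simp add: borel_prod)

lemma impulse_response_measurable:
  assumes "H \<in> HS"
  shows "(\<lambda>(t, x). impulse_response H t x) \<in> borel_measurable (borel \<Otimes>\<^sub>M borel)"
proof -
  have [measurable]: "HS_kernel H \<in> borel_measurable (borel \<Otimes>\<^sub>M borel)"
    using HS_kernel_L2[OF assms] unfolding L2_def mem_Collect_eq borel_measurable_lborel_pair_iff by blast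
  show ?thesis unfolding impulse_response_def by measurable
qed

lemma nn_integral_lborel_pair:
  assumes "f \<in> borel_measurable (borel \<Otimes>\<^sub>M borel)"
  shows "(\<integral>\<^sup>+z. f z \<partial>lborel) = (\<integral>\<^sup>+x. (\<integral>\<^sup>+y. f (x, y) \<partial>lborel) \<partial>(lborel :: real measure))"
  using assms unfolding lborel_prod[symmetric]
  by (intro lborel.nn_integral_fst[symmetric]) (simp add: measurable_lborel2 cong: measurable_cong_sets)

text \<open>The map from \<open>(t, x)\<close> to \<open>(x, x - t)\<close> preserves area, which is
  shown by exchanging the integrals and reflecting the inner variable.\<close>

lemma nn_integral_impulse_response:
  assumes "H \<in> HS"
  shows "(\<integral>\<^sup>+z. (norm (impulse_response H (fst z) (snd z)))\<^sup>2 \<partial>lborel) = ennreal ((HS_norm H)\<^sup>2)"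
proof -
  have [measurable]: "HS_kernel H \<in> borel_measurable (borel \<Otimes>\<^sub>M borel)"
    using HS_kernel_L2[OF assms] unfolding L2_def mem_Collect_eq borel_measurable_lborel_pair_iff by blast
  note impulse_response_measurable[OF assms, measurable]
  have "(\<integral>\<^sup>+z. (norm (impulse_response H (fst z) (snd z)))\<^sup>2 \<partial>lborel)
      = (\<integral>\<^sup>+t. (\<integral>\<^sup>+x. (norm (HS_kernel H (x, x - t)))\<^sup>2 \<partial>lborel) \<partial>lborel)"
    by (subst nn_integral_lborel_pair) (simp_all add: impulse_response_def)
  also have "\<dots> = (\<integral>\<^sup>+x. (\<integral>\<^sup>+t. (norm (HS_kernel H (x, x - t)))\<^sup>2 \<partial>lborel) \<partial>lborel)"
    by (rule lborel_pair.Fubini') (simp cong: measurable_cong_sets)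
  also have "\<dots> = (\<integral>\<^sup>+x. (\<integral>\<^sup>+s. (norm (HS_kernel H (x, s)))\<^sup>2 \<partial>lborel) \<partial>lborel)"
  proof (rule nn_integral_cong)
    fix x
    show "(\<integral>\<^sup>+t. (norm (HS_kernel H (x, x - t)))\<^sup>2 \<partial>lborel) = (\<integral>\<^sup>+s. (norm (HS_kernel H (x, s)))\<^sup>2 \<partial>lborel)"
      using nn_integral_real_affine[of "\<lambda>s. ennreal ((norm (HS_kernel H (x, s)))\<^sup>2)" "-1" x] by simp
  qed
  also have "\<dots> = (\<integral>\<^sup>+z. (norm (HS_kernel H z))\<^sup>2 \<partial>lborel)"
    by (subst nn_integral_lborel_pair) simp_all
  also have "\<dots> = ennreal ((HS_norm H)\<^sup>2)"
    unfolding HS_norm_def L2_norm_square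
    using HS_kernel_L2[OF assms] by (intro nn_integral_eq_integral) (auto simp: L2_def)
  finally show ?thesis .
qed

lemma integrable_impulse_response:
  assumes "H \<in> HS"
  shows "integrable lborel (\<lambda>z. (norm (impulse_response H (fst z) (snd z)))\<^sup>2)"
    and "(LINT z|lborel. (norm (impulse_response H (fst z) (snd z)))\<^sup>2) = (HS_norm H)\<^sup>2"
proof -
  have "(\<lambda>z. (norm (impulse_response H (fst z) (snd z)))\<^sup>2) \<in> borel_measurable lborel"
    using impulse_response_measurable[OF assms] by (simp add: borel_prod case_prod_unfold)
  with nn_integral_impulse_response[OF assms]
  show "integrable lborel (\<lambda>z. (norm (impulse_response H (fst z) (snd z)))\<^sup>2)"
    and "(LINT z|lborel. (norm (impulse_response H (fst z) (snd z)))\<^sup>2) = (HS_norm H)\<^sup>2"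
    by (auto simp: integrable_iff_bounded integral_eq_nn_integral)
qed

text \<open>Plancherel's identity for compact support is applied to each slice in \<open>t\<close>.
  Only almost every slice is known to be square-integrable, which is enough for the outer
  integral.\<close>

lemma nn_integral_truncated_spreading:
  assumes H: "H \<in> HS" and R: "R > 0"
  shows "(\<integral>\<^sup>+z. (norm (truncated_spreading H R z))\<^sup>2 \<partial>lborel)
    = (\<integral>\<^sup>+z. indicator {- R..R} (snd z) * (norm (impulse_response H (fst z) (snd z)))\<^sup>2 \<partial>lborel)"
    and "truncated_spreading H R \<in> borel_measurable (borel \<Otimes>\<^sub>M borel)"
proof -
  note impulse_response_measurable[OF H, measurable]
  have eq: "truncated_spreading H R = (\<lambda>z. LINT x|lborel.
      indicator {- R..R} x *\<^sub>R impulse_response H (fst z) x * cis (- 2 * pi * x * snd z))"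
    by (simp add: truncated_spreading_def set_lebesgue_integral_def case_prod_unfold)
  show m[measurable]: "truncated_spreading H R \<in> borel_measurable (borel \<Otimes>\<^sub>M borel)"
    unfolding eq by measurable
  have "AE t in lborel. (\<integral>\<^sup>+x. (norm (impulse_response H t x))\<^sup>2 \<partial>lborel) \<noteq> \<infinity>"
  proof (rule nn_integral_noteq_infinite)
    show "(\<integral>\<^sup>+t. (\<integral>\<^sup>+x. (norm (impulse_response H t x))\<^sup>2 \<partial>lborel) \<partial>lborel) \<noteq> \<infinity>"
      using nn_integral_impulse_response[OF H] by (subst (asm) nn_integral_lborel_pair) auto
  qed measurable
  then have "AE t in lborel. (\<integral>\<^sup>+\<nu>. (norm (truncated_spreading H R (t, \<nu>)))\<^sup>2 \<partial>lborel)
      = (\<integral>\<^sup>+x. indicator {- R..R} x * (norm (impulse_response H t x))\<^sup>2 \<partial>lborel)"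
  proof eventually_elim
    case (elim t)
    define f where "f x = indicator {- R..R} x *\<^sub>R impulse_response H t x" for x
    have [measurable]: "f \<in> borel_measurable borel" unfolding f_def by measurable
    have n: "(norm (f x))\<^sup>2 = indicator {- R..R} x * (norm (impulse_response H t x))\<^sup>2" for x
      by (simp add: f_def indicator_def)
    have "(\<integral>\<^sup>+x. (norm (f x))\<^sup>2 \<partial>lborel) \<le> (\<integral>\<^sup>+x. (norm (impulse_response H t x))\<^sup>2 \<partial>lborel)"
      unfolding n by (intro nn_integral_mono) (auto simp: indicator_def)
    then have "integrable lborel (\<lambda>x. (norm (f x))\<^sup>2)"
      using elim by (auto simp: integrable_iff_bounded less_top[symmetric] top_unique)
    from plancherel_compact_support[OF R _ this] have
      "(\<integral>\<^sup>+\<nu>. (norm (LINT x|lborel. f x * cis (- 2 * pi * x * \<nu>)))\<^sup>2 \<partial>lborel) = (\<integral>\<^sup>+x. (norm (f x))\<^sup>2 \<partial>lborel)"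
      by (simp add: f_def)
    then show ?case
      unfolding eq n by (simp add: f_def)
  qed
  then show "(\<integral>\<^sup>+z. (norm (truncated_spreading H R z))\<^sup>2 \<partial>lborel)
    = (\<integral>\<^sup>+z. indicator {- R..R} (snd z) * (norm (impulse_response H (fst z) (snd z)))\<^sup>2 \<partial>lborel)"
    by (subst (1 2) nn_integral_lborel_pair) (auto intro!: nn_integral_cong_AE)
qed

text \<open>
  \<open>L2_norm\<close> takes the junk value \<open>0\<close> off \<open>L2\<close>, so the limit in \<open>is_spreading_function\<close> carries
  information only because of the first claim below.
\<close>

lemma truncated_spreading_L2:
  assumes H: "H \<in> HS" and R: "R > 0"
  shows "truncated_spreading H R \<in> L2 lborel"
    and "(L2_norm lborel (truncated_spreading H R))\<^sup>2
      = (LINT z|lborel. indicator {- R..R} (snd z) * (norm (impulse_response H (fst z) (snd z)))\<^sup>2)"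
proof -
  note nn = nn_integral_truncated_spreading[OF H R]
  have m: "(\<lambda>z. indicator {- R..R} (snd z) * (norm (impulse_response H (fst z) (snd z)))\<^sup>2) \<in> borel_measurable lborel"
    using impulse_response_measurable[OF H] by (simp add: borel_prod[symmetric] case_prod_unfold)
  have "integrable lborel (\<lambda>z. indicator {- R..R} (snd z) * (norm (impulse_response H (fst z) (snd z)))\<^sup>2)"
    by (rule Bochner_Integration.integrable_bound[OF integrable_impulse_response(1)[OF H] m])
       (auto simp: indicator_def)
  from nn_integral_eq_integral[OF this] nn(1) have
    e: "(\<integral>\<^sup>+z. (norm (truncated_spreading H R z))\<^sup>2 \<partial>lborel)
    = ennreal (LINT z|lborel. indicator {- R..R} (snd z) * (norm (impulse_response H (fst z) (snd z)))\<^sup>2)"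
    by simp
  have m2: "truncated_spreading H R \<in> borel_measurable lborel"
    using nn(2) unfolding borel_measurable_lborel_pair_iff .
  then show "truncated_spreading H R \<in> L2 lborel"
    using e by (auto simp: L2_def integrable_iff_bounded)
  show "(L2_norm lborel (truncated_spreading H R))\<^sup>2
      = (LINT z|lborel. indicator {- R..R} (snd z) * (norm (impulse_response H (fst z) (snd z)))\<^sup>2)"
    unfolding L2_norm_square using e m2
    by (subst integral_eq_nn_integral) (auto intro!: integral_nonneg_AE)
qed

text \<open>The norms of the truncations are those of the impulse response restricted to
  \<open>{- R..R}\<close>. They converge to the full norm by dominated convergence, and the norm
  passes to the limit in \<open>L2\<close>.\<close>

lemma spreading_function_isometry:
  assumes H: "H \<in> HS" and \<eta>: "is_spreading_function H \<eta>"
  shows "(L2_norm lborel \<eta>)\<^sup>2 = (HS_norm H)\<^sup>2"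
proof (rule L2_norm_square_limit)
  show "\<eta> \<in> L2 lborel" "((\<lambda>R. L2_norm lborel (\<lambda>z. \<eta> z - truncated_spreading H R z)) \<longlongrightarrow> 0) at_top"
    using \<eta> by (auto simp: is_spreading_function_iff)
  show "\<forall>\<^sub>F R in at_top. truncated_spreading H R \<in> L2 lborel"
    using eventually_gt_at_top[of "0::real"] by eventually_elim (rule truncated_spreading_L2[OF H])
  have m: "(\<lambda>z. (norm (impulse_response H (fst z) (snd z)))\<^sup>2) \<in> borel_measurable lborel"
    using impulse_response_measurable[OF H] by (simp add: borel_prod case_prod_unfold)
  have mR: "(\<lambda>z. indicator {- R..R} (snd z) * (norm (impulse_response H (fst z) (snd z)))\<^sup>2) \<in> borel_measurable lborel" for R
    using impulse_response_measurable[OF H] by (simp add: borel_prod[symmetric] case_prod_unfold)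
  have "((\<lambda>R. LINT z|lborel. indicator {- R..R} (snd z) * (norm (impulse_response H (fst z) (snd z)))\<^sup>2)
      \<longlongrightarrow> (LINT z|lborel. (norm (impulse_response H (fst z) (snd z)))\<^sup>2)) at_top"
  proof (rule integral_dominated_convergence_at_top[OF m mR integrable_impulse_response(1)[OF H]])
    show "AE z in lborel. ((\<lambda>R. indicator {- R..R} (snd z) * (norm (impulse_response H (fst z) (snd z)))\<^sup>2)
      \<longlongrightarrow> (norm (impulse_response H (fst z) (snd z)))\<^sup>2) at_top"
    proof (rule AE_I2)
      fix z :: "real \<times> real"
      show "((\<lambda>R. indicator {- R..R} (snd z) * (norm (impulse_response H (fst z) (snd z)))\<^sup>2)
        \<longlongrightarrow> (norm (impulse_response H (fst z) (snd z)))\<^sup>2) at_top"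
        by (rule tendsto_eventually, use eventually_ge_at_top[of "\<bar>snd z\<bar>"] in eventually_elim)
             (auto simp: indicator_def)
    qed
  qed (auto simp: indicator_def)
  then show "((\<lambda>R. (L2_norm lborel (truncated_spreading H R))\<^sup>2) \<longlongrightarrow> (HS_norm H)\<^sup>2) at_top"
    unfolding integrable_impulse_response(2)[OF H]
    by (rule Lim_transform_eventually)
       (use eventually_gt_at_top[of "0::real"] in eventually_elim, simp add: truncated_spreading_L2(2)[OF H])
qed simp

text \<open>\<open>OPW\<close> bounds the support of some spreading function, whereas
  \<open>cont_impulse_response\<close> uses the chosen one; uniqueness transfers the support
  condition.\<close>

lemma spreading_function_unique:
  assumes H: "H \<in> HS" and \<eta>: "is_spreading_function H \<eta>" and \<eta>': "is_spreading_function H \<eta>'"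
  shows "AE z in lborel. \<eta> z = \<eta>' z"
proof (rule L2_limit_unique)
  show "\<forall>\<^sub>F R in at_top. truncated_spreading H R \<in> L2 lborel"
    using eventually_gt_at_top[of "0::real"] by eventually_elim (rule truncated_spreading_L2[OF H])
qed (use \<eta> \<eta>' in \<open>auto simp: is_spreading_function_iff\<close>)

section \<open>Sampling with weighted Dirac combs\<close>

text \<open>A geometric sum over powers of a \<open>K\<close>-th root of unity. The bound on
  \<open>d\<close> ensures that this root is 1 only for \<open>d = 0\<close>.\<close>

lemma sum_cis_multiples:
  fixes d :: int
  assumes K: "K > 0" and d: "\<bar>d\<bar> < int K"
  shows "(\<Sum>j<K. cis (2 * pi * real j * of_int d / real K)) = (if d = 0 then of_nat K else 0)"
proof (cases "d = 0")
  case False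
  define w where "w = cis (2 * pi * of_int d / real K)"
  have "w \<noteq> 1"
  proof
    assume "w = 1"
    then have "cos (2 * pi * of_int d / real K) = 1" by (simp add: w_def complex_eq_iff)
    then obtain m :: int where "2 * pi * of_int d / real K = of_int m * 2 * pi"
      by (auto simp: cos_one_2pi_int)
    then have "real_of_int d = of_int (m * int K)" using K by (simp add: field_simps)
    then have "d = m * int K" by (simp only: of_int_eq_iff)
    then have "int K dvd d" by simp
    then show False using False d zdvd_not_zless[of "\<bar>d\<bar>" "int K"] by auto
  qed
  moreover have "w ^ K = 1"
    using K by (simp add: w_def Complex.DeMoivre cis_multiple_2pi)
  moreover have "(\<Sum>j<K. cis (2 * pi * real j * of_int d / real K)) = (\<Sum>j<K. w ^ j)"
    by (simp add: w_def Complex.DeMoivre mult_ac)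
  ultimately show ?thesis using False by (simp add: geometric_sum)
qed simp

text \<open>The window holds \<open>K\<close> consecutive integers, so differences of its indices
  stay below \<open>K\<close> in absolute value and the off-diagonal terms vanish.\<close>

lemma sum_norm_square_cis:
  fixes b :: "int \<Rightarrow> complex"
  assumes K: "K > 0"
  shows "(\<Sum>j<K. (norm (\<Sum>n\<in>{a<..a + int K}. cis (2 * pi * real j * of_int n / real K) * b n))\<^sup>2)
    = real K * (\<Sum>n\<in>{a<..a + int K}. (norm (b n))\<^sup>2)"
proof -
  let ?A = "{a<..a + int K}"
  let ?e = "\<lambda>j n. cis (2 * pi * real j * of_int n / real K)"
  have "complex_of_real (\<Sum>j<K. (norm (\<Sum>n\<in>?A. ?e j n * b n))\<^sup>2)
      = (\<Sum>j<K. \<Sum>m\<in>?A. \<Sum>n\<in>?A. b m * cnj (b n) * (?e j m * ?e j (- n)))"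
    by (simp add: complex_norm_square sum_product cis_cnj mult_ac del: of_real_power)
  also have "\<dots> = (\<Sum>j<K. \<Sum>m\<in>?A. \<Sum>n\<in>?A. b m * cnj (b n) * ?e j (m - n))"
    by (simp add: cis_mult right_diff_distrib diff_divide_distrib)
  also have "\<dots> = (\<Sum>m\<in>?A. \<Sum>n\<in>?A. \<Sum>j<K. b m * cnj (b n) * ?e j (m - n))"
    by (subst sum.swap, intro sum.cong refl, rule sum.swap)
  also have "\<dots> = (\<Sum>m\<in>?A. \<Sum>n\<in>?A. b m * cnj (b n) * (if m - n = 0 then of_nat K else 0))"
    unfolding sum_distrib_left[symmetric]
    by (intro sum.cong refl arg_cong2[where f = "(*)"] sum_cis_multiples K) auto
  also have "\<dots> = (\<Sum>m\<in>?A. \<Sum>n\<in>?A. if n = m then of_nat K * (b m * cnj (b m)) else 0)"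
    by (intro sum.cong refl) auto
  also have "\<dots> = (\<Sum>m\<in>?A. of_nat K * (b m * cnj (b m)))" by simp
  also have "\<dots> = complex_of_real (real K * (\<Sum>n\<in>?A. (norm (b n))\<^sup>2))"
    by (simp add: complex_norm_square sum_distrib_left del: of_real_power)
  finally show ?thesis unfolding of_real_eq_iff .
qed

text \<open>Reduces measurability of an infinite sum to that of a parameter integral. Without
  summability, which for complex terms is absolute, both sides have the default value 0.\<close>

lemma infsum_eq_lebesgue_integral:
  fixes f :: "'k \<Rightarrow> complex"
  shows "(\<Sum>\<^sub>\<infinity>k. f k) = (LINT k|count_space UNIV. f k)"
proof (cases "Infinite_Set_Sum.abs_summable_on f UNIV")
  case True
  then show ?thesis by (simp add: infsetsum_infsum[symmetric] infsetsum_def)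
next
  case False
  then have "\<not> f summable_on UNIV"
    by (simp add: abs_summable_equivalent[symmetric] summable_on_iff_abs_summable_on_complex)
  then show ?thesis
    using not_summable_infsetsum_eq[OF False] by (simp add: infsum_not_exists infsetsum_def)
qed

lemma borel_measurable_infsum:
  fixes f :: "'k::countable \<Rightarrow> 'a \<Rightarrow> complex"
  assumes [measurable]: "\<And>k. f k \<in> borel_measurable M"
  shows "(\<lambda>x. \<Sum>\<^sub>\<infinity>k. f k x) \<in> borel_measurable M"
proof -
  interpret sigma_finite_measure "count_space (UNIV :: 'k set)"
    by (rule sigma_finite_measure_count_space)
  have "(\<lambda>(k, x). f k x) \<in> borel_measurable (count_space UNIV \<Otimes>\<^sub>M M)"
    by (rule measurable_pair_measure_countable1) auto
  then have "(\<lambda>(x, k). f k x) \<in> borel_measurable (M \<Otimes>\<^sub>M count_space UNIV)"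
    using measurable_compose[OF measurable_pair_swap'] by (fastforce simp: case_prod_unfold)
  then show ?thesis
    unfolding infsum_eq_lebesgue_integral by (rule borel_measurable_lebesgue_integral)
qed

lemma AE_lborel_shift:
  fixes s :: real
  assumes "AE x in lborel. P x"
  shows "AE x in lborel. P (x + s)"
proof -
  obtain N where N: "N \<in> null_sets lborel" "{x. \<not> P x} \<subseteq> N"
    using assms by (auto elim!: AE_E simp: null_sets_def)
  have "AE x in lborel. s + 1 * x \<notin> N"
    by (rule AE_borel_affine) (use N AE_not_in[OF N(1)] in \<open>auto simp: null_sets_def\<close>)
  then show ?thesis by eventually_elim (use N(2) in \<open>auto simp: add.commute\<close>)
qed

lemma is_spreading_function_spreading_function:
  assumes "is_spreading_function H \<eta>"
  shows "is_spreading_function H (spreading_function H)"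
  unfolding spreading_function_def by (rule someI[of "is_spreading_function H", OF assms])

lemma cont_impulse_response_measurable:
  assumes "is_spreading_function H \<eta>"
  shows "(\<lambda>(t, x). cont_impulse_response H t x) \<in> borel_measurable (borel \<Otimes>\<^sub>M borel)"
proof -
  have [measurable]: "spreading_function H \<in> borel_measurable (borel \<Otimes>\<^sub>M borel)"
    using is_spreading_function_spreading_function[OF assms]
    unfolding is_spreading_function_def L2_def mem_Collect_eq borel_measurable_lborel_pair_iff by blast
  show ?thesis unfolding cont_impulse_response_def by measurable
qed

lemma apply_diracs_measurable:
  fixes p :: "'k::countable \<Rightarrow> real"
  assumes "is_spreading_function H \<eta>"
  shows "apply_diracs H c p \<in> borel_measurable borel"
proof -
  note cont_impulse_response_measurable[OF assms, measurable]
  show ?thesis unfolding apply_diracs_def[abs_def]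
    by (rule borel_measurable_infsum) measurable
qed

text \<open>The interval is half-open so that exactly \<open>M * N\<close> indices occur for every
  \<open>x\<close>; a closed one would admit one more whenever \<open>real M * x\<close> is an
  integer. The index set has the shape \<open>{a<..a + int K}\<close> of
  \<open>sum_norm_square_cis\<close>.\<close>

lemma sample_in_interval_iff:
  fixes x :: real
  assumes "M > 0"
  shows "x - of_int n / real M \<in> {0..<real N} 
    \<longleftrightarrow> n \<in> {\<lfloor>real M * x\<rfloor> - int (M * N)<..\<lfloor>real M * x\<rfloor> - int (M * N) + int (M * N)}"
proof -
  have "x - of_int n / real M \<in> {0..<real N} \<longleftrightarrow> of_int n \<le> real M * x \<and> real M * x < of_int (n + int (M * N))"
    using assms by (auto simp: field_simps)
  also have "\<dots> \<longleftrightarrow> n \<le> \<lfloor>real M * x\<rfloor> \<and> \<lfloor>real M * x\<rfloor> < n + int (M * N)"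
    by (simp only: le_floor_iff floor_less_iff)
  finally show ?thesis by auto
qed

text \<open>Nonnegative integrals postpone the question whether the images lie in \<open>L2\<close>;
  the finite right-hand side answers it afterwards.\<close>

lemma sum_norm_square_apply_diracs:
  fixes M N :: nat and H :: operator
  assumes M: "M > 0" and N: "N > 0" and H: "H \<in> OPW ({0..real N} \<times> {- real M / 2..real M / 2})"
  shows "(\<Sum>j<M * N. \<integral>\<^sup>+x. (norm (apply_diracs H
        (\<lambda>n::int. cis (2 * pi * real j * real_of_int n / (real M * real N)))
        (\<lambda>n. real_of_int n / real M) x))\<^sup>2 \<partial>lborel) = ennreal ((real M)\<^sup>2 * real N * (HS_norm H)\<^sup>2)"
proof -
  define S where "S = {0..real N} \<times> {- real M / 2..real M / 2}"
  \<comment> \<open>The line \<open>t = N\<close> is a null set; removing it leaves exactly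
    \<open>M * N\<close> candidate indices at every \<open>x\<close>.\<close>
  define S' where "S' = {0..<real N} \<times> {- real M / 2..real M / 2}"
  obtain \<eta>0 where HS: "H \<in> HS" and \<eta>0: "is_spreading_function H \<eta>0" "ess_supp \<eta>0 \<subseteq> S"
    using H by (auto simp: OPW_def S_def)
  define \<eta> where "\<eta> = spreading_function H"
  have \<eta>: "is_spreading_function H \<eta>"
    unfolding \<eta>_def by (rule is_spreading_function_spreading_function[OF \<eta>0(1)])
  have \<eta>_L2: "\<eta> \<in> L2 lborel" using \<eta> by (simp add: is_spreading_function_def)
  then have [measurable]: "\<eta> \<in> borel_measurable (borel \<Otimes>\<^sub>M borel)"
    unfolding L2_def mem_Collect_eq borel_measurable_lborel_pair_iff by blast
  \<comment> \<open>\<open>G\<close> is a version of \<open>\<eta>\<close> that vanishes everywhere,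
    not just almost everywhere, outside \<open>S'\<close>.\<close>
  define G where "G z = indicator S' z *\<^sub>R \<eta> z" for z
  have [measurable]: "S' \<in> sets (borel \<Otimes>\<^sub>M borel)" unfolding S'_def by measurable
  have [measurable]: "G \<in> borel_measurable (borel \<Otimes>\<^sub>M borel)" unfolding G_def by measurable
  have "AE z in lborel. z \<notin> S \<longrightarrow> \<eta> z = 0"
    using AE_zero_outside_ess_supp[OF \<eta>0(2)] spreading_function_unique[OF HS \<eta> \<eta>0(1)]
    by eventually_elim auto
  then have "AE t in lborel. AE \<nu> in lborel. (t, \<nu>) \<notin> S \<longrightarrow> \<eta> (t, \<nu>) = 0"
    unfolding lborel_prod[symmetric] by (rule lborel_pair.AE_pair)
  then have \<eta>G: "AE t in lborel. AE \<nu> in lborel. \<eta> (t, \<nu>) = G (t, \<nu>)"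
    using AE_lborel_singleton[of "real N"]
  proof eventually_elim
    case (elim t)
    from elim(1) show ?case
      by eventually_elim (use elim(2) in \<open>auto simp: G_def S_def S'_def indicator_def\<close>)
  qed
  have nnG: "(\<integral>\<^sup>+t. (\<integral>\<^sup>+\<nu>. (norm (G (t, \<nu>)))\<^sup>2 \<partial>lborel) \<partial>lborel) = ennreal ((HS_norm H)\<^sup>2)"
  proof -
    have "(\<integral>\<^sup>+t. (\<integral>\<^sup>+\<nu>. (norm (G (t, \<nu>)))\<^sup>2 \<partial>lborel) \<partial>lborel)
        = (\<integral>\<^sup>+t. (\<integral>\<^sup>+\<nu>. (norm (\<eta> (t, \<nu>)))\<^sup>2 \<partial>lborel) \<partial>lborel)"
    proof (rule nn_integral_cong_AE, use \<eta>G in eventually_elim)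
      case (elim t)
      then show ?case by (intro nn_integral_cong_AE) (auto elim: eventually_mono)
    qed
    also have "\<dots> = (\<integral>\<^sup>+z. (norm (\<eta> z))\<^sup>2 \<partial>lborel)"
      by (subst nn_integral_lborel_pair) simp_all
    also have "\<dots> = ennreal ((L2_norm lborel \<eta>)\<^sup>2)"
      unfolding L2_norm_square using \<eta>_L2 by (intro nn_integral_eq_integral) (auto simp: L2_def)
    finally show ?thesis by (simp add: spreading_function_isometry[OF HS \<eta>])
  qed
  \<comment> \<open>On a good slice \<open>\<eta>\<close> may be replaced by \<open>G\<close> and
    Parseval's identity applies.\<close>
  define good where "good t \<longleftrightarrow> (AE \<nu> in lborel. \<eta> (t, \<nu>) = G (t, \<nu>))
      \<and> (\<integral>\<^sup>+\<nu>. (norm (G (t, \<nu>)))\<^sup>2 \<partial>lborel) \<noteq> \<infinity>" for t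
  have "AE t in lborel. (\<integral>\<^sup>+\<nu>. (norm (G (t, \<nu>)))\<^sup>2 \<partial>lborel) \<noteq> \<infinity>"
    by (rule nn_integral_noteq_infinite) (simp_all add: nnG)
  then have good: "AE t in lborel. good t"
    using \<eta>G unfolding good_def by eventually_elim auto
  \<comment> \<open>\<open>C\<close> vanishes for every \<open>t\<close> outside
    \<open>{0..<real N}\<close>, and \<open>cont_impulse_response\<close> agrees with it on good
    slices.\<close>
  define C where "C t x = (LINT \<nu>|lborel. G (t, \<nu>) * cis (2 * pi * x * \<nu>))" for t x
  have [measurable]: "(\<lambda>(t, x). C t x) \<in> borel_measurable (borel \<Otimes>\<^sub>M borel)"
    unfolding C_def by measurable
  have C: "cont_impulse_response H t x = C t x" if "good t" for t x
    unfolding cont_impulse_response_def C_def \<eta>_def[symmetric]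
    by (rule integral_cong_AE) (use that in \<open>auto simp: good_def elim: eventually_mono\<close>)
  have C0: "C t x = 0" if "t \<notin> {0..<real N}" for t x
  proof -
    have "G (t, \<nu>) = 0" for \<nu> using that by (auto simp: G_def S'_def indicator_def)
    then show ?thesis by (simp add: C_def)
  qed
  have samples: "(\<integral>\<^sup>+n. (norm (C t (t + of_int n / real M)))\<^sup>2 \<partial>count_space UNIV)
      = ennreal (real M) * (\<integral>\<^sup>+\<nu>. (norm (G (t, \<nu>)))\<^sup>2 \<partial>lborel)" if "good t" for t
  proof -
    \<comment> \<open>The modulation absorbs the base point \<open>t\<close>: the samples at
      \<open>t + n / M\<close> become the Fourier coefficients of \<open>f\<close> for the period
      \<open>M\<close>.\<close>
    define f where "f \<nu> = G (t, \<nu>) * cis (2 * pi * t * \<nu>)" for \<nu>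
    have nf: "norm (f \<nu>) = norm (G (t, \<nu>))" for \<nu> by (simp add: f_def norm_mult)
    have [measurable]: "f \<in> borel_measurable borel" unfolding f_def by measurable
    have "integrable lborel (\<lambda>\<nu>. (norm (f \<nu>))\<^sup>2)"
      using that unfolding integrable_iff_bounded good_def by (auto simp: nf less_top)
    moreover have "f \<nu> = 0" if "\<nu> \<notin> {- real M / 2..real M / 2}" for \<nu>
      using that by (auto simp: f_def G_def S'_def indicator_def)
    moreover have "C t (t + of_int n / real M) = (LINT \<nu>|lborel. f \<nu> * trig (real M) n \<nu>)" for n
      unfolding C_def by (intro Bochner_Integration.integral_cong refl)
        (simp add: f_def trig_def cis_mult ring_distribs mult_ac)
    ultimately show ?thesis
      using parseval[of "real M" f] M by (simp add: nf)
  qed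
  define K where "K = M * N"
  have K: "K > 0" using M N by (simp add: K_def)
  define Hf where "Hf j = apply_diracs H
        (\<lambda>n::int. cis (2 * pi * real j * real_of_int n / (real M * real N)))
        (\<lambda>n. real_of_int n / real M)" for j
  have [measurable]: "Hf j \<in> borel_measurable borel" for j
    unfolding Hf_def by (rule apply_diracs_measurable[OF \<eta>])
  \<comment> \<open>The exceptional sets of countably many shifts still form a null set, so almost
    every \<open>x\<close> has only good slices among all its \<open>x - n / M\<close>.\<close>
  have "AE x in lborel. \<forall>n::int. good (x + - (of_int n / real M))"
    using AE_lborel_shift[OF good] by (subst AE_all_countable) blast
  then have pointwise: "AE x in lborel. (\<Sum>j<K. ennreal ((norm (Hf j x))\<^sup>2))
      = ennreal (real K) * (\<integral>\<^sup>+n. (norm (C (x - of_int n / real M) x))\<^sup>2 \<partial>count_space UNIV)"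
  proof eventually_elim
    case (elim x)
    define b where "b n = C (x - of_int n / real M) x" for n :: int
    define a where "a = \<lfloor>real M * x\<rfloor> - int K"
    have b0: "b n = 0" if "n \<notin> {a<..a + int K}" for n
      using that C0 sample_in_interval_iff[OF M, of x n N] unfolding a_def b_def K_def by blast
    have Hf: "Hf j x = (\<Sum>n\<in>{a<..a + int K}. cis (2 * pi * real j * of_int n / real K) * b n)" for j
    proof -
      have "Hf j x = (\<Sum>\<^sub>\<infinity>n. cis (2 * pi * real j * of_int n / real K) * b n)"
        using elim by (simp add: Hf_def apply_diracs_def C b_def K_def)
      also have "\<dots> = (\<Sum>\<^sub>\<infinity>n\<in>{a<..a + int K}. cis (2 * pi * real j * of_int n / real K) * b n)"
        by (rule infsum_cong_neutral) (use b0 in auto)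
      finally show ?thesis by simp
    qed
    have "(\<Sum>j<K. ennreal ((norm (Hf j x))\<^sup>2)) = ennreal (\<Sum>j<K. (norm (Hf j x))\<^sup>2)"
      by (rule sum_ennreal) simp
    also have "\<dots> = ennreal (real K * (\<Sum>n\<in>{a<..a + int K}. (norm (b n))\<^sup>2))"
      unfolding Hf by (subst sum_norm_square_cis[OF K]) simp
    also have "\<dots> = ennreal (real K) * (\<Sum>n\<in>{a<..a + int K}. ennreal ((norm (b n))\<^sup>2))"
      by (subst sum_ennreal) (auto simp: ennreal_mult sum_nonneg)
    \<comment> \<open>Returning to all integers frees the range of summation from its dependence on
      \<open>x\<close>, so that sum and integral can be exchanged.\<close>
    also have "(\<Sum>n\<in>{a<..a + int K}. ennreal ((norm (b n))\<^sup>2)) = (\<integral>\<^sup>+n. (norm (b n))\<^sup>2 \<partial>count_space UNIV)"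
      by (rule nn_integral_count_space'[symmetric]) (use b0 in auto)
    finally show ?case by (simp add: b_def)
  qed
  have "(\<Sum>j<K. \<integral>\<^sup>+x. (norm (Hf j x))\<^sup>2 \<partial>lborel) = (\<integral>\<^sup>+x. (\<Sum>j<K. ennreal ((norm (Hf j x))\<^sup>2)) \<partial>lborel)"
    by (rule nn_integral_sum[symmetric]) measurable
  also have "\<dots> = (\<integral>\<^sup>+x. ennreal (real K) * (\<integral>\<^sup>+n. (norm (C (x - of_int n / real M) x))\<^sup>2 \<partial>count_space UNIV) \<partial>lborel)"
    by (rule nn_integral_cong_AE[OF pointwise])
  also have "\<dots> = (\<integral>\<^sup>+x. (\<integral>\<^sup>+n. ennreal (real K) * (norm (C (x - of_int n / real M) x))\<^sup>2 \<partial>count_space UNIV) \<partial>lborel)"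
    by (simp add: nn_integral_cmult)
  also have "\<dots> = (\<integral>\<^sup>+n. (\<integral>\<^sup>+x. ennreal (real K) * (norm (C (x - of_int n / real M) x))\<^sup>2 \<partial>lborel) \<partial>count_space UNIV)"
    by (rule nn_integral_count_space_nn_integral) auto
  also have "\<dots> = ennreal (real K) * (\<integral>\<^sup>+n. (\<integral>\<^sup>+x. (norm (C (x - of_int n / real M) x))\<^sup>2 \<partial>lborel) \<partial>count_space UNIV)"
    by (simp add: nn_integral_cmult)
  also have "(\<integral>\<^sup>+n. (\<integral>\<^sup>+x. (norm (C (x - of_int n / real M) x))\<^sup>2 \<partial>lborel) \<partial>count_space UNIV)
      = (\<integral>\<^sup>+n. (\<integral>\<^sup>+t. (norm (C t (t + of_int n / real M)))\<^sup>2 \<partial>lborel) \<partial>count_space UNIV)"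
  proof (rule nn_integral_cong)
    \<comment> \<open>For fixed \<open>n\<close> the substitution \<open>x = t + n / M\<close> makes
      the delay the variable of integration; afterwards each slice \<open>t\<close> carries its own
      sequence of samples.\<close>
    fix n :: int
    show "(\<integral>\<^sup>+x. (norm (C (x - of_int n / real M) x))\<^sup>2 \<partial>lborel)
        = (\<integral>\<^sup>+t. (norm (C t (t + of_int n / real M)))\<^sup>2 \<partial>lborel)"
      using nn_integral_real_affine[of "\<lambda>x. ennreal ((norm (C (x - of_int n / real M) x))\<^sup>2)" 1 "of_int n / real M"]
      by (simp add: add.commute)
  qed
  also have "\<dots> = (\<integral>\<^sup>+t. (\<integral>\<^sup>+n. (norm (C t (t + of_int n / real M)))\<^sup>2 \<partial>count_space UNIV) \<partial>lborel)"
    by (rule nn_integral_count_space_nn_integral[symmetric]) auto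
  also have "\<dots> = (\<integral>\<^sup>+t. ennreal (real M) * (\<integral>\<^sup>+\<nu>. (norm (G (t, \<nu>)))\<^sup>2 \<partial>lborel) \<partial>lborel)"
    using good by (intro nn_integral_cong_AE) (auto elim!: eventually_mono simp: samples)
  also have "\<dots> = ennreal (real M) * ennreal ((HS_norm H)\<^sup>2)"
    by (subst nn_integral_cmult) (simp_all add: nnG)
  also have "ennreal (real K) * (ennreal (real M) * ennreal ((HS_norm H)\<^sup>2))
      = ennreal ((real M)\<^sup>2 * real N * (HS_norm H)\<^sup>2)"
  proof -
    have "(real M)\<^sup>2 * real N * (HS_norm H)\<^sup>2 = real K * (real M * (HS_norm H)\<^sup>2)"
      by (simp add: K_def power2_eq_square)
    show ?thesis unfolding \<open>_ = real K * _\<close> by (simp add: ennreal_mult)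
  qed
  finally show ?thesis by (simp add: K_def Hf_def)
qed

text \<open>Membership in \<open>L2\<close> is asserted separately because \<open>L2_norm\<close> is
  0 for measurable functions that are not square-integrable, which the norm formula alone would not
  exclude.\<close>

theorem theorem5p1:
  fixes M N :: nat and H :: operator
  assumes "M > 0" and "N > 0"
    and "H \<in> OPW ({0..real N} \<times> {- real M / 2..real M / 2})"
  shows "let Hf = (\<lambda>j::nat. apply_diracs H
        (\<lambda>n::int. cis (2 * pi * real j * real_of_int n / (real M * real N)))
        (\<lambda>n::int. real_of_int n / real M))
    in (\<forall>j < M * N. Hf j \<in> L2 lborel) \<and>
       (HS_norm H)\<^sup>2 = 1 / ((real M)\<^sup>2 * real N) * (\<Sum>j = 0..M * N - 1. (L2_norm lborel (Hf j))\<^sup>2)"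
proof -
  define Hf where "Hf = (\<lambda>j::nat. apply_diracs H
        (\<lambda>n::int. cis (2 * pi * real j * real_of_int n / (real M * real N)))
        (\<lambda>n::int. real_of_int n / real M))"
  have total: "(\<Sum>j<M * N. \<integral>\<^sup>+x. (norm (Hf j x))\<^sup>2 \<partial>lborel) = ennreal ((real M)\<^sup>2 * real N * (HS_norm H)\<^sup>2)"
    unfolding Hf_def by (rule sum_norm_square_apply_diracs[OF assms])
  have m[measurable]: "Hf j \<in> borel_measurable lborel" for j
    using assms(3) unfolding Hf_def OPW_def by (auto intro: apply_diracs_measurable)
  \<comment> \<open>Each integral is at most the total, which is finite.\<close>
  have int: "integrable lborel (\<lambda>x. (norm (Hf j x))\<^sup>2)" if "j < M * N" for j
  proof -
    have "(\<integral>\<^sup>+x. (norm (Hf j x))\<^sup>2 \<partial>lborel) \<le> (\<Sum>j<M * N. \<integral>\<^sup>+x. (norm (Hf j x))\<^sup>2 \<partial>lborel)"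
      by (rule member_le_sum) (use that in auto)
    then have "(\<integral>\<^sup>+x. (norm (Hf j x))\<^sup>2 \<partial>lborel) < \<infinity>"
      unfolding total using ennreal_less_top le_less_trans by (metis infinity_ennreal_def)
    then show ?thesis by (simp add: integrable_iff_bounded)
  qed
  have "ennreal ((real M)\<^sup>2 * real N * (HS_norm H)\<^sup>2) = (\<Sum>j<M * N. ennreal ((L2_norm lborel (Hf j))\<^sup>2))"
    unfolding total[symmetric] L2_norm_square
    by (intro sum.cong refl nn_integral_eq_integral int) auto
  also have "\<dots> = ennreal (\<Sum>j<M * N. (L2_norm lborel (Hf j))\<^sup>2)" by (rule sum_ennreal) simp
  finally have "(real M)\<^sup>2 * real N * (HS_norm H)\<^sup>2 = (\<Sum>j<M * N. (L2_norm lborel (Hf j))\<^sup>2)"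
    by (subst (asm) ennreal_inj) (auto intro: sum_nonneg)
  \<comment> \<open>Subtraction of naturals stops at 0; positivity of \<open>M * N\<close> makes the
    two index ranges agree.\<close>
  moreover have "{..<M * N} = {0..M * N - 1}" using assms(1,2)
    by (cases "M * N") (auto simp: lessThan_Suc_atMost atLeast0AtMost)
  ultimately have "(HS_norm H)\<^sup>2 = 1 / ((real M)\<^sup>2 * real N) * (\<Sum>j = 0..M * N - 1. (L2_norm lborel (Hf j))\<^sup>2)"
    using assms(1,2) by (simp add: field_simps)
  then show ?thesis
    using int m by (simp add: Hf_def[symmetric] L2_def)
qed

end
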